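(* Let $\Gamma$ be a biconnected finite simplicial graph such that the flag complex $\Delta_\Gamma$ is simply connected. If $\Gamma$ has a redundant triangle, then the Bestvina--Brady group $BB_\Gamma$ is not (isomorphic to) a right-angled Artin group.
   Context: All graphs are finite simplicial graphs. A graph is biconnected if it is connected and has no cut vertex. The flag complex $\Delta_\Gamma$ is the simplicial complex whose simplices are the nonempty sets of pairwise adjacent vertices of $\Gamma$. The right-angled Artin group on a finite simplicial graph $\Gamma$ is $A_\Gamma=\langle V(\Gamma)\mid [v,w] \text{ whenever } (v,w)\in E(\Gamma)\rangle$, and $BB_\Gamma$ is the kernel of the homomorphism $A_\Gamma\to\mathbb Z$ sending every vertex generator to $1$. The link $\operatorname{lk}(v,\Gamma)$ of a vertex $v$ is the full subgraph induced by the vertices adjacent to $v$. A subgraph $\Lambda\subseteq\Gamma$ is separating if the full subgraph spanned by $V(\Gamma)\setminus V(\Lambda)$ is disconnected. A minimal full separating subgraph is a full separating subgraph none of whose proper full subgraphs is separating in $\Gamma$. Redundant triangle: let $\tau$ be a triangle of $\Delta_\Gamma$ with vertices $v_1,v_2,v_3$, and let $e_j$ be the edge of $\tau$ opposite to $v_j$. Then $\tau$ is redundant if for each $j=1,2,3$ there exists a subgraph $\Lambda_j\subseteq\operatorname{lk}(v_j,\Gamma)$ such that: (1) $e_j\in E(\Lambda_j)$; (2) $\Lambda_j$ is a minimal full separating subgraph of $\Gamma$; (3) $\Lambda_1\cap\Lambda_2\cap\Lambda_3$ is the empty subgraph. *)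

theory Defs
  imports
    "HOL-Analysis.Analysis"
    "HOL-Algebra.Elementary_Groups"
    "Graph_Theory.Digraph_Component"
begin

text \<open>
  A finite simplicial graph is a \<^term>\<open>G\<close> with \<open>graph G\<close>: a finite symmetric digraph without
  loops and parallel arcs. The full subgraph spanned by \<open>S\<close> is \<open>G \<restriction> S\<close>. Since the name
  \<open>connected\<close> also belongs to topology, the graph notion is always written qualified.
\<close>

section \<open>Biconnected graphs, links, separating subgraphs\<close>

text \<open>\<open>Digraph_Component.connected\<close> is false for the graph without vertices, which is not
  disconnected either.\<close>

definition disconnected :: "('a,'b) pre_digraph \<Rightarrow> bool" where
  "disconnected G \<longleftrightarrow> verts G \<noteq> {} \<and> \<not> Digraph_Component.connected G"

definition cut_vertex :: "('a,'b) pre_digraph \<Rightarrow> 'a \<Rightarrow> bool" where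
  "cut_vertex G v \<longleftrightarrow> v \<in> verts G \<and> disconnected (pre_digraph.del_vert G v)"

definition biconnected :: "('a,'b) pre_digraph \<Rightarrow> bool" where
  "biconnected G \<longleftrightarrow> Digraph_Component.connected G \<and> (\<nexists>v. cut_vertex G v)"

definition link :: "'a \<Rightarrow> ('a,'b) pre_digraph \<Rightarrow> ('a,'b) pre_digraph" where
  "link v G = G \<restriction> {u \<in> verts G. v \<rightarrow>\<^bsub>G\<^esub> u}"

definition separating_subgraph :: "('a,'b) pre_digraph \<Rightarrow> ('a,'b) pre_digraph \<Rightarrow> bool" where
  "separating_subgraph L G \<longleftrightarrow> subgraph L G \<and> disconnected (G \<restriction> (verts G - verts L))"

definition minimal_full_separating_subgraph ::
    "('a,'b) pre_digraph \<Rightarrow> ('a,'b) pre_digraph \<Rightarrow> bool" where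
  "minimal_full_separating_subgraph L G \<longleftrightarrow>
     induced_subgraph L G \<and> separating_subgraph L G \<and>
     (\<forall>L'. induced_subgraph L' L \<and> L' \<noteq> L \<longrightarrow> \<not> separating_subgraph L' G)"

section \<open>Redundant triangles\<close>

definition triangle :: "('a,'b) pre_digraph \<Rightarrow> 'a \<Rightarrow> 'a \<Rightarrow> 'a \<Rightarrow> bool" where
  "triangle G v1 v2 v3 \<longleftrightarrow> v1 \<rightarrow>\<^bsub>G\<^esub> v2 \<and> v2 \<rightarrow>\<^bsub>G\<^esub> v3 \<and> v1 \<rightarrow>\<^bsub>G\<^esub> v3"

definition redundant_triangle :: "('a,'b) pre_digraph \<Rightarrow> 'a \<Rightarrow> 'a \<Rightarrow> 'a \<Rightarrow> bool" where
  "redundant_triangle G v1 v2 v3 \<longleftrightarrow> triangle G v1 v2 v3 \<and>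
     (\<exists>L1 L2 L3.
        subgraph L1 (link v1 G) \<and> subgraph L2 (link v2 G) \<and> subgraph L3 (link v3 G) \<and>
        v2 \<rightarrow>\<^bsub>L1\<^esub> v3 \<and> v1 \<rightarrow>\<^bsub>L2\<^esub> v3 \<and> v1 \<rightarrow>\<^bsub>L3\<^esub> v2 \<and>
        minimal_full_separating_subgraph L1 G \<and>
        minimal_full_separating_subgraph L2 G \<and>
        minimal_full_separating_subgraph L3 G \<and>
        verts L1 \<inter> verts L2 \<inter> verts L3 = {})"

section \<open>Flag complexes\<close>

definition flag_complex :: "('a,'b) pre_digraph \<Rightarrow> 'a set set" where
  "flag_complex G = {S. S \<noteq> {} \<and> S \<subseteq> verts G \<and> (\<forall>u\<in>S. \<forall>v\<in>S. u \<noteq> v \<longrightarrow> u \<rightarrow>\<^bsub>G\<^esub> v)}"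

text \<open>
  Points are given by barycentric coordinates and carry the subspace topology of the product
  topology on \<^typ>\<open>'a \<Rightarrow> real\<close>. For a complex with finitely many vertices this is the usual
  (Euclidean) topology.
\<close>

definition geometric_realization :: "'a set set \<Rightarrow> ('a \<Rightarrow> real) set" where
  "geometric_realization K =
     {x. (\<forall>v. 0 \<le> x v) \<and> {v. x v \<noteq> 0} \<in> K \<and> (\<Sum>v | x v \<noteq> 0. x v) = 1}"

section \<open>Group presentations\<close>

text \<open>
  The letters \<open>(x, True)\<close> and \<open>(x, False)\<close> stand for \<open>x\<close> and its inverse. The group with generators
  \<open>X\<close> and relators \<open>R\<close> consists of the words over \<open>X\<close> modulo the smallest congruence that cancels
  adjacent inverse letters and makes the relators trivial.
\<close>

type_synonym 'a gword = "('a \<times> bool) list"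

definition gwords :: "'a set \<Rightarrow> 'a gword set" where
  "gwords X = lists (X \<times> UNIV)"

inductive_set pres_rel :: "'a set \<Rightarrow> 'a gword set \<Rightarrow> ('a gword \<times> 'a gword) set"
  for X :: "'a set" and R :: "'a gword set" where
  pres_refl: "u \<in> gwords X \<Longrightarrow> (u, u) \<in> pres_rel X R"
| pres_sym: "(u, v) \<in> pres_rel X R \<Longrightarrow> (v, u) \<in> pres_rel X R"
| pres_trans: "(u, v) \<in> pres_rel X R \<Longrightarrow> (v, w) \<in> pres_rel X R \<Longrightarrow> (u, w) \<in> pres_rel X R"
| pres_cancel: "u \<in> gwords X \<Longrightarrow> v \<in> gwords X \<Longrightarrow> x \<in> X \<Longrightarrow>
    (u @ [(x, b), (x, \<not> b)] @ v, u @ v) \<in> pres_rel X R"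
| pres_relator: "u \<in> gwords X \<Longrightarrow> v \<in> gwords X \<Longrightarrow> r \<in> R \<Longrightarrow> r \<in> gwords X \<Longrightarrow>
    (u @ r @ v, u @ v) \<in> pres_rel X R"

definition presented_group :: "'a set \<Rightarrow> 'a gword set \<Rightarrow> 'a gword set monoid" where
  "presented_group X R =
     \<lparr> carrier = gwords X // pres_rel X R,
       monoid.mult = (\<lambda>A B. \<Union>a\<in>A. \<Union>b\<in>B. pres_rel X R `` {a @ b}),
       one = pres_rel X R `` {[]} \<rparr>"

section \<open>Right-angled Artin groups and Bestvina--Brady groups\<close>

definition commutator_word :: "'a \<Rightarrow> 'a \<Rightarrow> 'a gword" where
  "commutator_word v w = [(v, True), (w, True), (v, False), (w, False)]"

definition raag_relators :: "('a,'b) pre_digraph \<Rightarrow> 'a gword set" where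
  "raag_relators G = {commutator_word v w | v w. v \<rightarrow>\<^bsub>G\<^esub> w}"

definition raag :: "('a,'b) pre_digraph \<Rightarrow> 'a gword set monoid" where
  "raag G = presented_group (verts G) (raag_relators G)"

definition raag_generator :: "('a,'b) pre_digraph \<Rightarrow> 'a \<Rightarrow> 'a gword set" where
  "raag_generator G v = pres_rel (verts G) (raag_relators G) `` {[(v, True)]}"

definition exponent_sum :: "'a gword \<Rightarrow> int" where
  "exponent_sum w = (\<Sum>(x, b)\<leftarrow>w. if b then 1 else - 1)"

text \<open>
  The exponent sum is constant on congruence classes. The induced map is the unique homomorphism
  from \<open>raag G\<close> to the integers that sends every generator to \<open>1\<close>; see \<open>raag_height_hom\<close>,
  \<open>raag_height_generator\<close> and \<open>raag_height_unique\<close> below.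
\<close>

definition raag_height :: "('a,'b) pre_digraph \<Rightarrow> 'a gword set \<Rightarrow> int" where
  "raag_height G c = the_elem (exponent_sum ` c)"

definition bestvina_brady :: "('a,'b) pre_digraph \<Rightarrow> 'a gword set monoid" where
  "bestvina_brady G =
     (raag G)\<lparr>carrier := kernel (raag G) integer_group (raag_height G)\<rparr>"

section \<open>Basic facts\<close>

lemma gwords_simps [simp]:
  "[] \<in> gwords X"
  "(l # w) \<in> gwords X \<longleftrightarrow> fst l \<in> X \<and> w \<in> gwords X"
  "(u @ w) \<in> gwords X \<longleftrightarrow> u \<in> gwords X \<and> w \<in> gwords X"
  by (auto simp: gwords_def mem_Times_iff)

lemma pres_rel_words:
  "(u, v) \<in> pres_rel X R \<Longrightarrow> u \<in> gwords X \<and> v \<in> gwords X"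
  by (induction rule: pres_rel.induct) auto

lemma equiv_pres_rel: "equiv (gwords X) (pres_rel X R)"
proof (rule equivI)
  show "pres_rel X R \<subseteq> gwords X \<times> gwords X" using pres_rel_words by auto
  show "refl_on (gwords X) (pres_rel X R)" by (rule refl_onI) (rule pres_rel.pres_refl)
  show "sym (pres_rel X R)" by (rule symI) (rule pres_rel.pres_sym)
  show "trans (pres_rel X R)" by (rule transI) (rule pres_rel.pres_trans)
qed

lemma pres_rel_context:
  "(u, v) \<in> pres_rel X R \<Longrightarrow> a \<in> gwords X \<Longrightarrow> b \<in> gwords X \<Longrightarrow>
     (a @ u @ b, a @ v @ b) \<in> pres_rel X R"
proof (induction rule: pres_rel.induct)
  case (pres_refl u)
  then show ?case by (simp add: pres_rel.pres_refl)
next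
  case (pres_sym u v)
  then show ?case by (blast intro: pres_rel.pres_sym)
next
  case (pres_trans u v w)
  then show ?case by (blast intro: pres_rel.pres_trans)
next
  case (pres_cancel u v x c)
  then show ?case
    using pres_rel.pres_cancel[of "a @ u" X "v @ b" x c R] by simp
next
  case (pres_relator u v r)
  then show ?case
    using pres_rel.pres_relator[of "a @ u" X "v @ b" r R] by simp
qed

lemma pres_rel_append:
  assumes "(u, u') \<in> pres_rel X R" "(v, v') \<in> pres_rel X R"
  shows "(u @ v, u' @ v') \<in> pres_rel X R"
proof -
  have "(u @ v, u' @ v) \<in> pres_rel X R"
    using pres_rel_context[OF assms(1), of "[]" v] pres_rel_words[OF assms(2)] by simp
  moreover have "(u' @ v, u' @ v') \<in> pres_rel X R"
    using pres_rel_context[OF assms(2), of u' "[]"] pres_rel_words[OF assms(1)] by simp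
  ultimately show ?thesis by (rule pres_rel.pres_trans)
qed

lemma presented_group_mult:
  assumes "u \<in> gwords X" "v \<in> gwords X"
  shows "pres_rel X R `` {u} \<otimes>\<^bsub>presented_group X R\<^esub> pres_rel X R `` {v}
           = pres_rel X R `` {u @ v}"
proof -
  let ?cl = "\<lambda>w. pres_rel X R `` {w}"
  have eq: "?cl (a @ b) = ?cl (u @ v)" if "a \<in> ?cl u" "b \<in> ?cl v" for a b
    using that pres_rel_append[of u a X R v b]
    by (metis Image_singleton_iff equiv_class_eq equiv_pres_rel)
  have "(\<Union>a\<in>?cl u. \<Union>b\<in>?cl v. ?cl (a @ b)) = (\<Union>a\<in>?cl u. \<Union>b\<in>?cl v. ?cl (u @ v))"
    by (intro SUP_cong refl) (rule eq)
  moreover have "?cl u \<noteq> {}" "?cl v \<noteq> {}"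
    using assms by (auto intro: pres_rel.pres_refl)
  ultimately show ?thesis
    by (simp add: presented_group_def)
qed

lemma presented_group_carrierE:
  assumes "c \<in> carrier (presented_group X R)"
  obtains w where "w \<in> gwords X" "c = pres_rel X R `` {w}"
  using assms unfolding presented_group_def by (auto elim: quotientE)

lemma presented_group_carrierI:
  "w \<in> gwords X \<Longrightarrow> pres_rel X R `` {w} \<in> carrier (presented_group X R)"
  unfolding presented_group_def by (auto intro: quotientI)

lemma presented_group_one: "\<one>\<^bsub>presented_group X R\<^esub> = pres_rel X R `` {[]}"
  by (simp add: presented_group_def)

lemma pres_rel_left_inverse:
  assumes "w \<in> gwords X"
  shows "\<exists>w'\<in>gwords X. (w' @ w, []) \<in> pres_rel X R"
  using assms
proof (induction w)
  case Nil
  then show ?case by (intro bexI[of _ "[]"]) (auto intro: pres_rel.pres_refl)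
next
  case (Cons l w)
  obtain x b where l: "l = (x, b)" by (cases l)
  from Cons obtain w' where w': "w' \<in> gwords X" "(w' @ w, []) \<in> pres_rel X R" by auto
  have "(w' @ [(x, \<not> b), (x, b)] @ w, w' @ w) \<in> pres_rel X R"
    using pres_rel.pres_cancel[of w' X w x "\<not> b" R] w' Cons.prems l by simp
  then have "((w' @ [(x, \<not> b)]) @ l # w, []) \<in> pres_rel X R"
    using pres_rel.pres_trans[OF _ w'(2)] l by simp
  then show ?case
    using w' Cons.prems l by (intro bexI[of _ "w' @ [(x, \<not> b)]"]) auto
qed

lemma group_presented_group: "group (presented_group X R)"
proof (rule groupI)
  let ?P = "presented_group X R"
  show "\<one>\<^bsub>?P\<^esub> \<in> carrier ?P"
    by (simp add: presented_group_one presented_group_carrierI)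
  fix a assume "a \<in> carrier ?P"
  then obtain u where u: "u \<in> gwords X" "a = pres_rel X R `` {u}"
    by (rule presented_group_carrierE)
  show "\<one>\<^bsub>?P\<^esub> \<otimes>\<^bsub>?P\<^esub> a = a"
    using u by (simp add: presented_group_one presented_group_mult)
  obtain u' where u': "u' \<in> gwords X" "(u' @ u, []) \<in> pres_rel X R"
    using pres_rel_left_inverse[OF u(1)] by blast
  show "\<exists>y\<in>carrier ?P. y \<otimes>\<^bsub>?P\<^esub> a = \<one>\<^bsub>?P\<^esub>"
    using u u' equiv_class_eq[OF equiv_pres_rel u'(2)]
    by (intro bexI[of _ "pres_rel X R `` {u'}"])
       (simp_all add: presented_group_one presented_group_mult presented_group_carrierI)
  fix b assume "b \<in> carrier ?P"
  then obtain v where v: "v \<in> gwords X" "b = pres_rel X R `` {v}"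
    by (rule presented_group_carrierE)
  show "a \<otimes>\<^bsub>?P\<^esub> b \<in> carrier ?P"
    using u v by (simp add: presented_group_mult presented_group_carrierI)
  fix c assume "c \<in> carrier ?P"
  then obtain w where w: "w \<in> gwords X" "c = pres_rel X R `` {w}"
    by (rule presented_group_carrierE)
  show "a \<otimes>\<^bsub>?P\<^esub> b \<otimes>\<^bsub>?P\<^esub> c = a \<otimes>\<^bsub>?P\<^esub> (b \<otimes>\<^bsub>?P\<^esub> c)"
    using u v w by (simp add: presented_group_mult)
qed

lemma group_raag: "group (raag G)"
  unfolding raag_def by (rule group_presented_group)

lemma raag_generator_closed: "v \<in> verts G \<Longrightarrow> raag_generator G v \<in> carrier (raag G)"
  unfolding raag_def raag_generator_def by (rule presented_group_carrierI) simp

lemma exponent_sum_simps [simp]: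
  "exponent_sum [] = 0"
  "exponent_sum (l # w) = (if snd l then 1 else - 1) + exponent_sum w"
  "exponent_sum (u @ w) = exponent_sum u + exponent_sum w"
  by (auto simp: exponent_sum_def split: prod.splits)

lemma exponent_sum_raag:
  "(u, v) \<in> pres_rel (verts G) (raag_relators G) \<Longrightarrow> exponent_sum u = exponent_sum v"
  by (induction rule: pres_rel.induct) (auto simp: raag_relators_def commutator_word_def)

lemma raag_height_class:
  assumes "w \<in> gwords (verts G)"
  shows "raag_height G (pres_rel (verts G) (raag_relators G) `` {w}) = exponent_sum w"
proof -
  define c where "c = pres_rel (verts G) (raag_relators G) `` {w}"
  have "w \<in> c" using assms unfolding c_def by (auto intro: pres_rel.pres_refl)
  moreover have "exponent_sum v = exponent_sum w" if "v \<in> c" for v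
    using that exponent_sum_raag[of w v G] unfolding c_def by simp
  ultimately have "exponent_sum ` c = {exponent_sum w}" by blast
  then show ?thesis by (simp add: raag_height_def c_def)
qed

lemma raag_height_hom: "raag_height G \<in> hom (raag G) integer_group"
proof (rule homI)
  fix a b assume "a \<in> carrier (raag G)" "b \<in> carrier (raag G)"
  then obtain u v where "u \<in> gwords (verts G)" "a = pres_rel (verts G) (raag_relators G) `` {u}"
    "v \<in> gwords (verts G)" "b = pres_rel (verts G) (raag_relators G) `` {v}"
    unfolding raag_def by (metis presented_group_carrierE)
  then show "raag_height G (a \<otimes>\<^bsub>raag G\<^esub> b) = raag_height G a \<otimes>\<^bsub>integer_group\<^esub> raag_height G b"
    by (simp add: raag_def presented_group_mult raag_height_class)
qed simp

lemma raag_height_generator: "v \<in> verts G \<Longrightarrow> raag_height G (raag_generator G v) = 1"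
  by (simp add: raag_generator_def raag_height_class)

lemma raag_height_unique:
  assumes h: "h \<in> hom (raag G) integer_group"
    and gen: "\<And>v. v \<in> verts G \<Longrightarrow> h (raag_generator G v) = 1"
    and c: "c \<in> carrier (raag G)"
  shows "h c = raag_height G c"
proof -
  let ?X = "verts G" and ?R = "raag_relators G"
  let ?cl = "\<lambda>w. pres_rel ?X ?R `` {w}"
  interpret hom: group_hom "raag G" integer_group h
    using h by (simp add: group_hom_def group_hom_axioms_def group_raag)
  have one: "h (?cl []) = 0"
    using hom.hom_one by (simp add: raag_def presented_group_one)
  have mult: "h (?cl (u @ v)) = h (?cl u) + h (?cl v)"
    if "u \<in> gwords ?X" "v \<in> gwords ?X" for u v
    using hom.hom_mult[of "?cl u" "?cl v"] that
    by (simp add: raag_def presented_group_mult presented_group_carrierI)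
  have letter: "h (?cl [(x, b)]) = (if b then 1 else - 1)" if x: "x \<in> ?X" for x b
  proof -
    have pos: "h (?cl [(x, True)]) = 1" using gen[OF x] by (simp add: raag_generator_def)
    have "([(x, True), (x, False)], []) \<in> pres_rel ?X ?R"
      using pres_rel.pres_cancel[of "[]" ?X "[]" x True ?R] x by simp
    then have "?cl ([(x, True)] @ [(x, False)]) = ?cl []"
      using equiv_class_eq[OF equiv_pres_rel] by simp
    then have "h (?cl [(x, True)]) + h (?cl [(x, False)]) = 0"
      using mult[of "[(x, True)]" "[(x, False)]"] one x by simp
    then show ?thesis using pos by (cases b) auto
  qed
  have "h (?cl w) = exponent_sum w" if "w \<in> gwords ?X" for w
    using that
  proof (induction w)
    case (Cons l w)
    then show ?case
      using mult[of "[l]" w] letter[of "fst l" "snd l"] by simp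
  qed (simp add: one)
  moreover obtain w where "w \<in> gwords ?X" "c = ?cl w"
    using c unfolding raag_def by (rule presented_group_carrierE)
  ultimately show ?thesis by (simp add: raag_height_class)
qed

lemma group_bestvina_brady: "group (bestvina_brady G)"
proof -
  interpret group_hom "raag G" integer_group "raag_height G"
    by (simp add: group_hom_def group_hom_axioms_def group_raag raag_height_hom)
  show ?thesis
    unfolding bestvina_brady_def by (rule subgroup.subgroup_is_group[OF subgroup_kernel group_raag])
qed

end

theory Submission
  imports Defs
begin

text \<open>
  Call a character \<open>\<alpha>\<close> of a group resonant if its cup product with some character that is not a multiple of
  \<open>\<alpha>\<close> vanishes. For a right-angled Artin group, resonance of \<open>\<alpha>\<close> depends only on the set of generators on
  which \<open>\<alpha>\<close> is nonzero, so every maximal subspace of resonant characters is a coordinate subspace.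

  Characters of \<open>BB\<^sub>\<Gamma>\<close> are functions on the vertices of \<open>\<Gamma>\<close> modulo constants. For biconnected \<open>\<Gamma>\<close> with
  simply connected flag complex, such a function is resonant iff it is constant on some separating set of
  vertices, so the maximal subspaces are the spaces \<open>E(N)\<close> of functions constant on a minimal separating
  set \<open>N\<close>. Coordinate subspaces generate a distributive lattice, but the three spaces \<open>E(N)\<close> coming from a
  redundant triangle do not.
\<close>

section \<open>Resonant characters\<close>

text \<open>Cup products are handled through explicit cochains. A vanishing product forces
  \<open>\<alpha> g * \<beta> h = \<alpha> h * \<beta> g\<close> on commuting pairs; conversely, if
  this holds along the edges of the graph, the two functions define a homomorphism to the Heisenberg
  group, whose corner entry is a suitable cochain. For a right-angled Artin group the two conditions
  coincide. For the kernel they do not: the commuting pairs used there come from triangles and say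
  only that the three points \<open>(x v, y v)\<close> of a triangle are collinear. Turning this
  local condition into a separating set is where simple connectivity enters.

  Biconnectivity gives every separating set at least two elements, so being constant on it is a
  genuine condition and \<open>E(N)\<close> remembers \<open>N\<close>. Subspaces of resonant
  characters are compared with the spaces \<open>E(N)\<close> through the fact that a real vector
  space is not a finite union of proper subspaces.\<close>

definition additive_character :: "('g, 'm) monoid_scheme \<Rightarrow> ('g \<Rightarrow> real) \<Rightarrow> bool" where
  "additive_character G \<alpha> \<longleftrightarrow>
     (\<forall>g\<in>carrier G. \<forall>h\<in>carrier G. \<alpha> (g \<otimes>\<^bsub>G\<^esub> h) = \<alpha> g + \<alpha> h)"

text \<open>The function \<open>f\<close> is a cochain whose coboundary is the cup product of \<open>\<alpha>\<close> and \<open>\<beta>\<close>.\<close>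

definition cup_vanishes :: "('g, 'm) monoid_scheme \<Rightarrow> ('g \<Rightarrow> real) \<Rightarrow> ('g \<Rightarrow> real) \<Rightarrow> bool" where
  "cup_vanishes G \<alpha> \<beta> \<longleftrightarrow>
     (\<exists>f :: 'g \<Rightarrow> real. \<forall>g\<in>carrier G. \<forall>h\<in>carrier G. f (g \<otimes>\<^bsub>G\<^esub> h) = f g + f h + \<alpha> g * \<beta> h)"

definition resonant :: "('g, 'm) monoid_scheme \<Rightarrow> ('g \<Rightarrow> real) \<Rightarrow> bool" where
  "resonant G \<alpha> \<longleftrightarrow> (\<exists>\<beta>. additive_character G \<beta> \<and> cup_vanishes G \<alpha> \<beta> \<and>
     \<not> (\<exists>c. \<forall>g\<in>carrier G. \<beta> g = c * \<alpha> g))"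

lemma resonant_cong:
  assumes "\<And>g. g \<in> carrier G \<Longrightarrow> \<alpha> g = \<alpha>' g"
  shows "resonant G \<alpha> \<longleftrightarrow> resonant G \<alpha>'"
  unfolding resonant_def cup_vanishes_def using assms by simp

lemma additive_character_comp_iso:
  "\<phi> \<in> iso G H \<Longrightarrow> additive_character H \<alpha> \<Longrightarrow> additive_character G (\<alpha> \<circ> \<phi>)"
  by (auto simp: additive_character_def iso_def hom_def Pi_iff)

lemma resonant_comp_iso:
  assumes \<phi>: "\<phi> \<in> iso G H" and r: "resonant H \<alpha>"
  shows "resonant G (\<alpha> \<circ> \<phi>)"
proof -
  obtain \<beta> f where \<beta>: "additive_character H \<beta>"
    and f: "\<And>g h. g \<in> carrier H \<Longrightarrow> h \<in> carrier H \<Longrightarrow> f (g \<otimes>\<^bsub>H\<^esub> h) = f g + f h + \<alpha> g * \<beta> h"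
    and n: "\<not> (\<exists>c. \<forall>g\<in>carrier H. \<beta> g = c * \<alpha> g)"
    using r unfolding resonant_def cup_vanishes_def by blast
  have hom: "\<phi> \<in> hom G H" and im: "\<phi> ` carrier G = carrier H"
    using \<phi> by (auto simp: iso_def bij_betw_def)
  have "cup_vanishes G (\<alpha> \<circ> \<phi>) (\<beta> \<circ> \<phi>)"
    unfolding cup_vanishes_def
    by (rule exI[of _ "f \<circ> \<phi>"]) (use f hom in \<open>auto simp: hom_def Pi_iff\<close>)
  moreover have "\<not> (\<exists>c. \<forall>g\<in>carrier G. (\<beta> \<circ> \<phi>) g = c * (\<alpha> \<circ> \<phi>) g)"
  proof
    assume "\<exists>c. \<forall>g\<in>carrier G. (\<beta> \<circ> \<phi>) g = c * (\<alpha> \<circ> \<phi>) g"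
    then obtain c where c: "\<And>g. g \<in> carrier G \<Longrightarrow> \<beta> (\<phi> g) = c * \<alpha> (\<phi> g)" by auto
    have "\<beta> h = c * \<alpha> h" if "h \<in> carrier H" for h
    proof -
      have "h \<in> \<phi> ` carrier G" using that im by simp
      then show ?thesis using c by auto
    qed
    with n show False by blast
  qed
  ultimately show ?thesis
    using additive_character_comp_iso[OF \<phi> \<beta>] unfolding resonant_def by blast
qed

text \<open>Comparing the two values of the cochain at \<open>g \<otimes> h = h \<otimes> g\<close>
  leaves only the products. This is the sole consequence of a vanishing cup product that the
  necessity directions use.\<close>

lemma cup_vanishes_commute:
  assumes "cup_vanishes G \<alpha> \<beta>" "g \<in> carrier G" "h \<in> carrier G" "g \<otimes>\<^bsub>G\<^esub> h = h \<otimes>\<^bsub>G\<^esub> g"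
  shows "\<alpha> g * \<beta> h = \<alpha> h * \<beta> g"
proof -
  obtain f where f: "\<forall>g\<in>carrier G. \<forall>h\<in>carrier G. f (g \<otimes>\<^bsub>G\<^esub> h) = f g + f h + \<alpha> g * \<beta> h"
    using assms(1) unfolding cup_vanishes_def by blast
  have "f (g \<otimes>\<^bsub>G\<^esub> h) = f g + f h + \<alpha> g * \<beta> h" "f (h \<otimes>\<^bsub>G\<^esub> g) = f h + f g + \<alpha> h * \<beta> g"
    using f assms(2,3) by blast+
  with assms(4) show ?thesis by simp
qed

lemma (in group) additive_character_one:
  assumes "additive_character G \<alpha>"
  shows "\<alpha> \<one> = 0"
  using assms one_closed l_one unfolding additive_character_def by (metis add_cancel_right_right)

lemma (in group) additive_character_inv:
  assumes "additive_character G \<alpha>" "g \<in> carrier G"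
  shows "\<alpha> (inv g) = - \<alpha> g"
proof -
  have "\<alpha> (g \<otimes> inv g) = \<alpha> g + \<alpha> (inv g)"
    using assms inv_closed unfolding additive_character_def by blast
  then show ?thesis using additive_character_one[OF assms(1)] assms(2) by simp
qed

section \<open>Characters of right-angled Artin groups\<close>

fun word_sum :: "('a \<Rightarrow> real) \<Rightarrow> 'a gword \<Rightarrow> real" where
  "word_sum x [] = 0"
| "word_sum x (l # w) = (if snd l then x (fst l) else - x (fst l)) + word_sum x w"

text \<open>
  The entry in the upper right corner of the product of the Heisenberg matrices
  \<open>exp (\<plusminus>(x v * X + y v * Y))\<close> along a word, which explains the term \<open>x v * y v / 2\<close>.
\<close>

fun word_area :: "('a \<Rightarrow> real) \<Rightarrow> ('a \<Rightarrow> real) \<Rightarrow> 'a gword \<Rightarrow> real" where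
  "word_area x y [] = 0"
| "word_area x y (l # w) = x (fst l) * y (fst l) / 2
     + (if snd l then x (fst l) else - x (fst l)) * word_sum y w + word_area x y w"

lemma word_sum_append [simp]: "word_sum x (u @ w) = word_sum x u + word_sum x w"
  by (induction u) auto

lemma word_area_append [simp]:
  "word_area x y (u @ w) = word_area x y u + word_area x y w + word_sum x u * word_sum y w"
  by (induction u) (auto simp: algebra_simps)

lemma word_sum_raag:
  "(u, v) \<in> pres_rel (verts G) (raag_relators G) \<Longrightarrow> word_sum x u = word_sum x v"
  by (induction rule: pres_rel.induct) (auto simp: raag_relators_def commutator_word_def)

text \<open>On a pair of inverse letters the two half terms cancel the product term. On
  \<open>commutator_word a b\<close> the area is \<open>x a * y b - x b * y a\<close>, which the
  hypothesis makes zero.\<close>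

lemma word_area_raag:
  assumes "\<And>u v. u \<rightarrow>\<^bsub>G\<^esub> v \<Longrightarrow> x u * y v = x v * y u"
  shows "(u, v) \<in> pres_rel (verts G) (raag_relators G) \<Longrightarrow> word_area x y u = word_area x y v"
proof (induction rule: pres_rel.induct)
  case (pres_cancel u v z b)
  then show ?case by (cases b) (auto simp: algebra_simps)
next
  case (pres_relator u v r)
  then obtain a b where ab: "a \<rightarrow>\<^bsub>G\<^esub> b" "r = commutator_word a b"
    by (auto simp: raag_relators_def)
  have "word_sum y r = 0" "word_sum x r = 0" using ab by (auto simp: commutator_word_def)
  moreover have "word_area x y r = 0"
    using assms[OF ab(1)] ab(2) by (simp add: commutator_word_def algebra_simps)
  ultimately show ?case by simp
qed auto

abbreviation word_class :: "('a,'b) pre_digraph \<Rightarrow> 'a gword \<Rightarrow> 'a gword set" where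
  "word_class G w \<equiv> pres_rel (verts G) (raag_relators G) `` {w}"

lemma raag_carrierE:
  assumes "c \<in> carrier (raag G)"
  obtains w where "w \<in> gwords (verts G)" "c = word_class G w"
  using assms presented_group_carrierE unfolding raag_def by blast

lemma word_class_closed: "w \<in> gwords (verts G) \<Longrightarrow> word_class G w \<in> carrier (raag G)"
  unfolding raag_def by (rule presented_group_carrierI)

lemma word_class_mult:
  "u \<in> gwords (verts G) \<Longrightarrow> w \<in> gwords (verts G) \<Longrightarrow>
     word_class G u \<otimes>\<^bsub>raag G\<^esub> word_class G w = word_class G (u @ w)"
  unfolding raag_def by (rule presented_group_mult)

lemma word_class_Nil: "word_class G [] = \<one>\<^bsub>raag G\<^esub>"
  unfolding raag_def by (simp add: presented_group_one)

lemma word_class_eqI: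
  "(u, w) \<in> pres_rel (verts G) (raag_relators G) \<Longrightarrow> word_class G u = word_class G w"
  by (rule equiv_class_eq[OF equiv_pres_rel])

text \<open>A representative is chosen, so \<open>raag_character\<close> below mentions no graph and
  one function serves as a character of both \<open>raag G\<close> and
  \<open>bestvina_brady G\<close>. The value is meaningful when \<open>f\<close> is constant on the
  class.\<close>

definition class_value :: "('w \<Rightarrow> real) \<Rightarrow> 'w set \<Rightarrow> real" where
  "class_value f c = f (SOME w. w \<in> c)"

lemma class_value_word_class:
  assumes "w \<in> gwords (verts G)"
    and "\<And>u v. (u, v) \<in> pres_rel (verts G) (raag_relators G) \<Longrightarrow> f u = f v"
  shows "class_value f (word_class G w) = f w"
proof -
  have "w \<in> word_class G w" using assms(1) by (auto intro: pres_rel.pres_refl)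
  then have "(SOME u. u \<in> word_class G w) \<in> word_class G w" by (rule someI)
  then show ?thesis using assms(2) unfolding class_value_def by simp
qed

abbreviation raag_character :: "('a \<Rightarrow> real) \<Rightarrow> 'a gword set \<Rightarrow> real" where
  "raag_character x \<equiv> class_value (word_sum x)"

lemma raag_character_class:
  "w \<in> gwords (verts G) \<Longrightarrow> raag_character x (word_class G w) = word_sum x w"
  by (rule class_value_word_class) (auto dest: word_sum_raag)

lemma raag_character_generator:
  "v \<in> verts G \<Longrightarrow> raag_character x (raag_generator G v) = x v"
  using raag_character_class[of "[(v, True)]" G x] by (simp add: raag_generator_def)

lemma additive_raag_character: "additive_character (raag G) (raag_character x)"
  unfolding additive_character_def
  by (auto elim!: raag_carrierE simp: word_class_mult raag_character_class)

lemma raag_character_linear: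
  assumes "g \<in> carrier (raag G)"
  shows "raag_character (\<lambda>v. a v + t * b v) g = raag_character a g + t * raag_character b g"
proof -
  have "word_sum (\<lambda>v. a v + t * b v) w = word_sum a w + t * word_sum b w" for w
    by (induction w) (auto simp: algebra_simps)
  then show ?thesis using assms by (auto elim!: raag_carrierE simp: raag_character_class)
qed

lemma raag_character_unique:
  assumes \<alpha>: "additive_character (raag G) \<alpha>" and c: "c \<in> carrier (raag G)"
  shows "\<alpha> c = raag_character (\<lambda>v. \<alpha> (raag_generator G v)) c"
proof -
  interpret group "raag G" by (rule group_raag)
  have "\<alpha> (word_class G w) = word_sum (\<lambda>v. \<alpha> (raag_generator G v)) w"
    if "w \<in> gwords (verts G)" for w
    using that
  proof (induction w)
    case Nil
    then show ?case by (simp only: word_class_Nil additive_character_one[OF \<alpha>] word_sum.simps)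
  next
    case (Cons l w)
    obtain v b where l: "l = (v, b)" by (cases l)
    have v: "v \<in> verts G" and w: "w \<in> gwords (verts G)" using Cons.prems l by auto
    have mult: "\<alpha> (word_class G (u @ w)) = \<alpha> (word_class G u) + \<alpha> (word_class G w)"
      if "u \<in> gwords (verts G)" "w \<in> gwords (verts G)" for u w
      using \<alpha> that unfolding additive_character_def
      by (metis word_class_closed word_class_mult)
    have "([(v, True)] @ [(v, False)], []) \<in> pres_rel (verts G) (raag_relators G)"
      using pres_rel.pres_cancel[of "[]" "verts G" "[]" v True "raag_relators G"] v by simp
    then have "\<alpha> (word_class G ([(v, True)] @ [(v, False)])) = 0"
      using word_class_eqI word_class_Nil additive_character_one[OF \<alpha>] by metis
    then have "\<alpha> (word_class G [(v, False)]) = - \<alpha> (word_class G [(v, True)])"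
      using mult[of "[(v, True)]" "[(v, False)]"] v by simp
    then show ?case
      using mult[of "[l]" w] Cons.IH[OF w] v w l by (auto simp: raag_generator_def)
  qed
  then show ?thesis using c by (auto elim!: raag_carrierE simp: raag_character_class)
qed

section \<open>Resonance in right-angled Artin groups\<close>

lemma raag_generators_commute:
  assumes uv: "u \<rightarrow>\<^bsub>G\<^esub> v" and V: "u \<in> verts G" "v \<in> verts G"
  shows "raag_generator G u \<otimes>\<^bsub>raag G\<^esub> raag_generator G v
       = raag_generator G v \<otimes>\<^bsub>raag G\<^esub> raag_generator G u"
proof -
  let ?R = "pres_rel (verts G) (raag_relators G)"
  \<comment> \<open>The word \<open>?r @ ?w\<close> becomes \<open>?w\<close> by removing the
    relator, and \<open>u v\<close> by two cancellations.\<close>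
  let ?r = "commutator_word u v" and ?w = "[(v, True), (u, True)]"
  have "([] @ ?r @ ?w, [] @ ?w) \<in> ?R"
    by (rule pres_rel.pres_relator) (use uv V in \<open>auto simp: raag_relators_def commutator_word_def\<close>)
  moreover have "(([(u, True), (v, True), (u, False)]) @ [(v, False), (v, \<not> False)] @ [(u, True)],
      [(u, True), (v, True), (u, False)] @ [(u, True)]) \<in> ?R"
    by (rule pres_rel.pres_cancel) (use V in auto)
  moreover have "([(u, True), (v, True)] @ [(u, False), (u, \<not> False)] @ [],
      [(u, True), (v, True)] @ []) \<in> ?R"
    by (rule pres_rel.pres_cancel) (use V in auto)
  ultimately have "([(u, True), (v, True)], ?w) \<in> ?R"
    by (simp add: commutator_word_def) (meson pres_rel.pres_sym pres_rel.pres_trans)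
  then have "word_class G [(u, True), (v, True)] = word_class G ?w"
    by (rule word_class_eqI)
  then show ?thesis using V by (simp add: raag_generator_def word_class_mult)
qed

lemma cup_vanishes_raag:
  assumes "\<And>u v. u \<rightarrow>\<^bsub>G\<^esub> v \<Longrightarrow> x u * y v = x v * y u"
  shows "cup_vanishes (raag G) (raag_character x) (raag_character y)"
  unfolding cup_vanishes_def
proof (intro exI[of _ "class_value (word_area x y)"] ballI)
  have area: "class_value (word_area x y) (word_class G w) = word_area x y w"
    if "w \<in> gwords (verts G)" for w
    using that assms by (intro class_value_word_class) (auto intro: word_area_raag)
  fix g h assume "g \<in> carrier (raag G)" "h \<in> carrier (raag G)"
  then show "class_value (word_area x y) (g \<otimes>\<^bsub>raag G\<^esub> h) = class_value (word_area x y) g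
      + class_value (word_area x y) h + raag_character x g * raag_character y h"
    by (auto elim!: raag_carrierE simp: word_class_mult raag_character_class area)
qed

lemma resonant_raag_iff:
  assumes "wf_digraph G"
  shows "resonant (raag G) (raag_character x) \<longleftrightarrow>
    (\<exists>y. (\<forall>u v. u \<rightarrow>\<^bsub>G\<^esub> v \<longrightarrow> x u * y v = x v * y u) \<and> \<not> (\<exists>c. \<forall>v\<in>verts G. y v = c * x v))"
  (is "?L \<longleftrightarrow> ?R")
proof
  assume ?L
  then obtain \<beta> where \<beta>: "additive_character (raag G) \<beta>"
    and cup: "cup_vanishes (raag G) (raag_character x) \<beta>"
    and n: "\<not> (\<exists>c. \<forall>g\<in>carrier (raag G). \<beta> g = c * raag_character x g)"
    unfolding resonant_def by blast
  define y where "y = (\<lambda>v. \<beta> (raag_generator G v))"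
  have "x u * y v = x v * y u" if uv: "u \<rightarrow>\<^bsub>G\<^esub> v" for u v
  proof -
    have V: "u \<in> verts G" "v \<in> verts G"
      using wf_digraph.adj_in_verts[OF assms uv] by auto
    show ?thesis
      using cup_vanishes_commute[OF cup raag_generator_closed raag_generator_closed raag_generators_commute]
        uv V by (simp add: y_def raag_character_generator)
  qed
  moreover have "\<not> (\<exists>c. \<forall>v\<in>verts G. y v = c * x v)"
  proof
    assume "\<exists>c. \<forall>v\<in>verts G. y v = c * x v"
    then obtain c where c: "\<And>v. v \<in> verts G \<Longrightarrow> y v = c * x v" by blast
    have "word_sum y w = c * word_sum x w" if "w \<in> gwords (verts G)" for w
      using that by (induction w) (auto simp: c algebra_simps)
    then have "\<beta> g = c * raag_character x g" if "g \<in> carrier (raag G)" for g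
      using raag_character_unique[OF \<beta> that] that
      by (auto elim!: raag_carrierE simp: raag_character_class simp flip: y_def)
    with n show False by blast
  qed
  ultimately show ?R by blast
next
  assume ?R
  then obtain y where y: "\<And>u v. u \<rightarrow>\<^bsub>G\<^esub> v \<Longrightarrow> x u * y v = x v * y u"
    and n: "\<not> (\<exists>c. \<forall>v\<in>verts G. y v = c * x v)" by blast
  have "\<not> (\<exists>c. \<forall>g\<in>carrier (raag G). raag_character y g = c * raag_character x g)"
  proof
    assume "\<exists>c. \<forall>g\<in>carrier (raag G). raag_character y g = c * raag_character x g"
    then obtain c where "\<forall>g\<in>carrier (raag G). raag_character y g = c * raag_character x g" by blast
    then have "\<forall>v\<in>verts G. y v = c * x v"
      using raag_generator_closed raag_character_generator by metis
    with n show False by blast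
  qed
  then show ?L
    unfolding resonant_def
    by (intro exI[of _ "raag_character y"] conjI additive_raag_character cup_vanishes_raag y)
qed

text \<open>Resonance means that the support of \<open>x\<close> spans a disconnected subgraph or
  that some vertex outside it has no neighbour in it. A smaller support keeps one of these
  alternatives: either it still meets two pieces, or a vertex of a piece that it misses is isolated
  from it.\<close>

lemma resonant_raag_shrink_support:
  assumes G: "wf_digraph G" "symmetric G"
    and res: "resonant (raag G) (raag_character x)"
    and supp: "\<And>v. v \<in> verts G \<Longrightarrow> x v = 0 \<Longrightarrow> x' v = 0"
  shows "resonant (raag G) (raag_character x')"
proof -
  obtain y where y: "\<And>u v. u \<rightarrow>\<^bsub>G\<^esub> v \<Longrightarrow> x u * y v = x v * y u"
    and n: "\<not> (\<exists>c. \<forall>v\<in>verts G. y v = c * x v)"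
    using res resonant_raag_iff[OF G(1)] by blast
  have adj: "u \<in> verts G" "v \<in> verts G" "v \<rightarrow>\<^bsub>G\<^esub> u" if "u \<rightarrow>\<^bsub>G\<^esub> v" for u v
    using wf_digraph.adj_in_verts[OF G(1) that] arcs_ends_symmetric[OF G(2) that] by auto
  define \<delta> :: "'a \<Rightarrow> 'a \<Rightarrow> real" where "\<delta> v = (\<lambda>w. if w = v then 1 else 0)" for v
  \<comment> \<open>The second alternative: the indicator of \<open>v\<close> is a witness, since
    both sides of the edge condition vanish.\<close>
  have single: ?thesis if v: "v \<in> verts G" "x' v = 0" and nb: "\<And>u. v \<rightarrow>\<^bsub>G\<^esub> u \<Longrightarrow> x' u = 0" for v
  proof -
    have "x' u * \<delta> v w = x' w * \<delta> v u" if "u \<rightarrow>\<^bsub>G\<^esub> w" for u w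
      using nb[of u] nb[of w] adj(3)[OF that] that v by (auto simp: \<delta>_def)
    moreover have "\<not> (\<exists>c. \<forall>w\<in>verts G. \<delta> v w = c * x' w)"
      using v by (auto simp: \<delta>_def)
    ultimately show ?thesis using resonant_raag_iff[OF G(1)] by blast
  qed
  show ?thesis
  proof (cases "\<exists>v\<in>verts G. x v = 0 \<and> y v \<noteq> 0")
    case True
    then obtain v where v: "v \<in> verts G" "x v = 0" "y v \<noteq> 0" by blast
    show ?thesis
    proof (rule single[OF v(1) supp[OF v(1,2)]])
      fix u assume "v \<rightarrow>\<^bsub>G\<^esub> u"
      then show "x' u = 0" using y[of v u] v adj supp by auto
    qed
  next
    case False
    \<comment> \<open>Where \<open>x v = 0\<close> the quotient is 0 by convention, and
      \<open>y v = r v * x v\<close> still holds because \<open>y\<close> vanishes there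
      too.\<close>
    define r where "r v = y v / x v" for v
    have yr: "y v = r v * x v" if "v \<in> verts G" for v
      using False that by (auto simp: r_def)
    have r: "r u = r v" if "u \<rightarrow>\<^bsub>G\<^esub> v" "x u \<noteq> 0" "x v \<noteq> 0" for u v
      using y[OF that(1)] that by (simp add: r_def field_simps)
    show ?thesis
    proof (cases "\<exists>\<rho>. \<forall>v\<in>verts G. x' v \<noteq> 0 \<longrightarrow> r v = \<rho>")
      case True
      then obtain \<rho> where \<rho>: "\<And>v. v \<in> verts G \<Longrightarrow> x' v \<noteq> 0 \<Longrightarrow> r v = \<rho>" by blast
      \<comment> \<open>A vertex whose ratio differs from \<open>\<rho>\<close> lies outside the
        support of \<open>x'\<close> and, as ratios agree along edges inside the support of
        \<open>x\<close>, has no neighbour in the support of \<open>x'\<close>.\<close>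
      obtain v where v: "v \<in> verts G" "y v \<noteq> \<rho> * x v" using n by blast
      then have xv: "x v \<noteq> 0" "r v \<noteq> \<rho>" using yr[OF v(1)] by auto
      show ?thesis
      proof (rule single[OF v(1)])
        show "x' v = 0" using \<rho>[OF v(1)] xv by blast
        fix u assume vu: "v \<rightarrow>\<^bsub>G\<^esub> u"
        then have "u \<in> verts G" using adj by blast
        then show "x' u = 0" using \<rho>[of u] supp[of u] r[OF vu] xv by force
      qed
    next
      case False
      have "x' u * (r v * x' v) = x' v * (r u * x' u)" if uv: "u \<rightarrow>\<^bsub>G\<^esub> v" for u v
      proof (cases "x' u = 0 \<or> x' v = 0")
        case False
        then have "x u \<noteq> 0" "x v \<noteq> 0" using supp adj[OF uv] by blast+
        then show ?thesis using r[OF uv] by simp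
      qed auto
      moreover have "\<not> (\<exists>c. \<forall>v\<in>verts G. r v * x' v = c * x' v)"
        using False by auto
      ultimately show ?thesis
        unfolding resonant_raag_iff[OF G(1)]
        by (intro exI[of _ "\<lambda>v. r v * x' v"] conjI allI impI)
    qed
  qed
qed

section \<open>Characters of Bestvina--Brady groups\<close>

lemma carrier_bestvina_brady:
  "carrier (bestvina_brady G) = {g \<in> carrier (raag G). raag_height G g = 0}"
  by (auto simp: bestvina_brady_def kernel_def)

lemma mult_bestvina_brady [simp]:
  "g \<otimes>\<^bsub>bestvina_brady G\<^esub> h = g \<otimes>\<^bsub>raag G\<^esub> h"
  by (simp add: bestvina_brady_def)

lemma one_bestvina_brady [simp]: "\<one>\<^bsub>bestvina_brady G\<^esub> = \<one>\<^bsub>raag G\<^esub>"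
  by (simp add: bestvina_brady_def)

text \<open>The powers of \<open>gen r\<close> represent all heights and so complement the kernel;
  paths from \<open>r\<close> express \<open>gen v \<cdot> invA (gen r)\<close> through differences
  along edges.\<close>

locale raag_over_graph =
  fixes G :: "('a,'b) pre_digraph" and r :: 'a
  assumes wf: "wf_digraph G"
    and root: "r \<in> verts G"
    and root_reaches: "v \<in> verts G \<Longrightarrow> (r, v) \<in> (arcs_ends G)\<^sup>*"
begin

sublocale A: group "raag G" by (rule group_raag)
sublocale BB: group "bestvina_brady G" by (rule group_bestvina_brady)
sublocale height: group_hom "raag G" integer_group "raag_height G"
  by (simp add: group_hom_def group_hom_axioms_def group_raag raag_height_hom)

abbreviation gen :: "'a \<Rightarrow> 'a gword set" where "gen \<equiv> raag_generator G"
abbreviation ht :: "'a gword set \<Rightarrow> int" where "ht \<equiv> raag_height G"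

abbreviation mulA (infixl \<open>\<cdot>\<close> 70) where "g \<cdot> h \<equiv> g \<otimes>\<^bsub>raag G\<^esub> h"
abbreviation invA where "invA \<equiv> m_inv (raag G)"

lemma adj_verts: "u \<rightarrow>\<^bsub>G\<^esub> v \<Longrightarrow> u \<in> verts G \<and> v \<in> verts G"
  using wf_digraph.adj_in_verts[OF wf] by blast

lemmas gen_closed [simp] = raag_generator_closed

lemma ht_mult [simp]:
  "g \<in> carrier (raag G) \<Longrightarrow> h \<in> carrier (raag G) \<Longrightarrow> ht (g \<cdot> h) = ht g + ht h"
  using height.hom_mult[of g h] by simp

lemma ht_inv [simp]: "g \<in> carrier (raag G) \<Longrightarrow> ht (invA g) = - ht g"
  using height.hom_inv[of g] by simp

lemma BB_carrier_iff: "g \<in> carrier (bestvina_brady G) \<longleftrightarrow> g \<in> carrier (raag G) \<and> ht g = 0"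
  by (simp add: carrier_bestvina_brady)

lemma gen_diff_closed:
  "u \<in> verts G \<Longrightarrow> v \<in> verts G \<Longrightarrow> gen u \<cdot> invA (gen v) \<in> carrier (bestvina_brady G)"
  by (simp add: BB_carrier_iff raag_height_generator)

lemma ht_pow: "v \<in> verts G \<Longrightarrow> ht (gen v [^]\<^bsub>raag G\<^esub> (n::int)) = n"
  using height.hom_int_pow[of "gen v" n] by (simp add: raag_height_generator)

lemma conj_commuting:
  assumes "g \<in> carrier (raag G)" "h \<in> carrier (raag G)" "h \<cdot> g = g \<cdot> h"
  shows "h \<cdot> g \<cdot> invA h = g"
  using assms by (simp add: A.m_assoc)

lemma mult_inv_cancel [simp]:
  assumes "g \<in> carrier (raag G)" "h \<in> carrier (raag G)"
  shows "invA g \<cdot> (g \<cdot> h) = h" "g \<cdot> (invA g \<cdot> h) = h"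
  using assms by (simp_all flip: A.m_assoc)

lemma inv_commutes:
  assumes "g \<in> carrier (raag G)" "h \<in> carrier (raag G)" "g \<cdot> h = h \<cdot> g"
  shows "invA g \<cdot> h = h \<cdot> invA g"
proof -
  have "(invA g \<cdot> h) \<cdot> g = invA g \<cdot> (g \<cdot> h)" using assms by (simp add: A.m_assoc)
  also have "\<dots> = h" using assms(1,2) by (simp flip: A.m_assoc)
  finally show ?thesis using assms(1,2) by (simp add: A.inv_solve_right)
qed

lemma int_pow_commutes:
  assumes g: "g \<in> carrier (raag G)" and h: "h \<in> carrier (raag G)" and c: "g \<cdot> h = h \<cdot> g"
  shows "(g [^]\<^bsub>raag G\<^esub> (n::int)) \<cdot> h = h \<cdot> (g [^]\<^bsub>raag G\<^esub> n)"
proof (cases n)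
  case (nonneg m)
  then show ?thesis using A.group_commutes_pow[OF c g h] by (simp add: int_pow_int)
next
  case (neg m)
  let ?p = "g [^]\<^bsub>raag G\<^esub> Suc m"
  have p: "?p \<in> carrier (raag G)" using g by blast
  have "?p \<cdot> h = h \<cdot> ?p" by (rule A.group_commutes_pow[OF c g h])
  then have "invA ?p \<cdot> h = h \<cdot> invA ?p" by (rule inv_commutes[OF p h])
  then show ?thesis
    unfolding neg A.int_pow_neg_int[OF g] by simp
qed

section \<open>Characters of the kernel extend to the whole group\<close>

context
  fixes \<psi> :: "'a gword set \<Rightarrow> real"
  assumes \<psi>: "additive_character (bestvina_brady G) \<psi>"
begin

lemma char_mult:
  "g \<in> carrier (bestvina_brady G) \<Longrightarrow> h \<in> carrier (bestvina_brady G) \<Longrightarrow> \<psi> (g \<cdot> h) = \<psi> g + \<psi> h"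
  using \<psi> unfolding additive_character_def by simp

lemma char_one: "\<psi> \<one>\<^bsub>raag G\<^esub> = 0"
  using BB.additive_character_one[OF \<psi>] by simp

lemma char_inv:
  assumes "g \<in> carrier (bestvina_brady G)"
  shows "\<psi> (invA g) = - \<psi> g"
proof -
  have "g \<in> carrier (raag G)" "invA g \<in> carrier (bestvina_brady G)"
    using assms by (auto simp: BB_carrier_iff)
  then show ?thesis using char_mult[OF assms, of "invA g"] char_one by simp
qed

text \<open>The elements \<open>g\<close> and \<open>h\<close> differ by a factor in the kernel, and
  conjugation within the kernel does not affect a character. So conjugation acts on characters
  through the height alone.\<close>

lemma char_conj_height:
  assumes g: "g \<in> carrier (raag G)" and h: "h \<in> carrier (raag G)" and "ht g = ht h"
    and k: "k \<in> carrier (bestvina_brady G)"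
  shows "\<psi> (g \<cdot> k \<cdot> invA g) = \<psi> (h \<cdot> k \<cdot> invA h)"
proof -
  define m where "m = g \<cdot> invA h"
  define k' where "k' = h \<cdot> k \<cdot> invA h"
  have kA: "k \<in> carrier (raag G)" using k by (simp add: BB_carrier_iff)
  have m: "m \<in> carrier (bestvina_brady G)" "invA m \<in> carrier (bestvina_brady G)"
    and k': "k' \<in> carrier (bestvina_brady G)"
    using assms by (auto simp: BB_carrier_iff m_def k'_def)
  have mh: "m \<cdot> h = g" using g h by (simp add: m_def A.m_assoc)
  have mA: "m \<in> carrier (raag G)" using m by (simp add: BB_carrier_iff)
  have "g \<cdot> k \<cdot> invA g = (m \<cdot> h) \<cdot> k \<cdot> invA (m \<cdot> h)" by (simp add: mh)
  also have "\<dots> = m \<cdot> k' \<cdot> invA m"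
    using mA h kA by (simp add: k'_def A.inv_mult_group A.m_assoc)
  finally have e: "g \<cdot> k \<cdot> invA g = m \<cdot> k' \<cdot> invA m" .
  have "m \<cdot> k' \<in> carrier (bestvina_brady G)" using m k' by (auto simp: BB_carrier_iff)
  then show ?thesis
    unfolding e using m k' by (simp add: char_mult char_inv flip: k'_def)
qed

text \<open>The conjugator may be replaced by the power of \<open>gen w\<close> of the same height,
  which commutes with both \<open>gen u\<close> and \<open>gen w\<close>.\<close>

lemma char_conj_edge:
  assumes uw: "u \<rightarrow>\<^bsub>G\<^esub> w" and g: "g \<in> carrier (raag G)"
  shows "\<psi> (g \<cdot> (gen w \<cdot> invA (gen u)) \<cdot> invA g) = \<psi> (gen w \<cdot> invA (gen u))"
proof -
  define h where "h = gen w [^]\<^bsub>raag G\<^esub> ht g"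
  have V: "u \<in> verts G" "w \<in> verts G" using adj_verts[OF uw] by auto
  have c: "gen w \<cdot> gen u = gen u \<cdot> gen w"
    using raag_generators_commute[OF uw V] by simp
  have hA: "h \<in> carrier (raag G)" using V by (simp add: h_def)
  have hu: "h \<cdot> gen u = gen u \<cdot> h" and hw: "h \<cdot> gen w = gen w \<cdot> h"
    unfolding h_def using V c by (simp_all add: int_pow_commutes)
  have hu': "h \<cdot> invA (gen u) = invA (gen u) \<cdot> h"
    using inv_commutes[of "gen u" h] hu hA V by simp
  have "h \<cdot> (gen w \<cdot> invA (gen u)) = (gen w \<cdot> invA (gen u)) \<cdot> h"
    using hA V hw hu' by (simp add: A.m_assoc flip: hu') (simp flip: A.m_assoc add: hw)
  then have "h \<cdot> (gen w \<cdot> invA (gen u)) \<cdot> invA h = gen w \<cdot> invA (gen u)"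
    using hA V by (intro conj_commuting) auto
  moreover have "ht g = ht h" using V by (simp add: h_def ht_pow)
  ultimately show ?thesis
    using char_conj_height[OF g hA _ gen_diff_closed[OF V(2,1)]] by simp
qed

text \<open>Along a path from the root the difference telescopes into edge differences, each of
  which is invariant.\<close>

lemma char_conj_root:
  assumes v: "v \<in> verts G" and g: "g \<in> carrier (raag G)"
  shows "\<psi> (g \<cdot> (gen v \<cdot> invA (gen r)) \<cdot> invA g) = \<psi> (gen v \<cdot> invA (gen r))"
proof -
  have "v \<in> verts G \<longrightarrow> \<psi> (g \<cdot> (gen v \<cdot> invA (gen r)) \<cdot> invA g) = \<psi> (gen v \<cdot> invA (gen r))"
    using root_reaches[OF v]
  proof induction
    case base
    then show ?case using root g by simp
  next
    case (step u w)
    have V: "u \<in> verts G" "w \<in> verts G" using adj_verts[OF step.hyps(2)] by auto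
    let ?a = "gen w \<cdot> invA (gen u)" and ?b = "gen u \<cdot> invA (gen r)"
    have ab: "?a \<in> carrier (bestvina_brady G)" "?b \<in> carrier (bestvina_brady G)"
      using V root by (auto intro: gen_diff_closed)
    have abA: "?a \<in> carrier (raag G)" "?b \<in> carrier (raag G)"
      using ab by (auto simp: BB_carrier_iff)
    have e: "gen w \<cdot> invA (gen r) = ?a \<cdot> ?b"
      using V root by (simp add: A.m_assoc)
    have conj: "g \<cdot> k \<cdot> invA g \<in> carrier (bestvina_brady G)"
      if "k \<in> carrier (bestvina_brady G)" for k
      using that g by (auto simp: BB_carrier_iff)
    have "g \<cdot> (?a \<cdot> ?b) \<cdot> invA g = (g \<cdot> ?a \<cdot> invA g) \<cdot> (g \<cdot> ?b \<cdot> invA g)"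
      using abA g V root by (simp add: A.m_assoc)
    then show ?case
      unfolding e using ab conj char_conj_edge[OF step.hyps(2) g] step.IH V by (simp add: char_mult)
  qed
  with v show ?thesis by blast
qed

text \<open>Dividing \<open>g\<close> by the power of \<open>gen r\<close> of the same height
  projects the whole group onto the kernel. The projection is not a homomorphism, but it fails only
  by conjugations, which \<open>\<psi>\<close> does not see; hence \<open>D\<close> grows by
  \<open>x v\<close> with each letter \<open>v\<close>.\<close>

lemma char_extends:
  assumes g: "g \<in> carrier (bestvina_brady G)"
  shows "\<psi> g = raag_character (\<lambda>v. \<psi> (gen v \<cdot> invA (gen r))) g"
proof -
  define x where "x v = \<psi> (gen v \<cdot> invA (gen r))" for v
  define p where "p n = gen r [^]\<^bsub>raag G\<^esub> (n::int)" for n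
  define D where "D g = \<psi> (g \<cdot> invA (p (ht g)))" for g
  have p: "p n \<in> carrier (raag G)" "ht (p n) = n" for n
    using root by (auto simp: p_def ht_pow)
  have p1: "p (n + 1) = p n \<cdot> gen r" for n
    using A.int_pow_mult[of "gen r" n 1] root by (simp add: p_def)
  have red: "g \<cdot> invA (p (ht g)) \<in> carrier (bestvina_brady G)" if "g \<in> carrier (raag G)" for g
    using that p by (simp add: BB_carrier_iff)
  have step: "D (g \<cdot> gen v) = D g + x v" if g: "g \<in> carrier (raag G)" and v: "v \<in> verts G" for g v
  proof -
    let ?q = "p (ht g)"
    have k: "?q \<cdot> (gen v \<cdot> invA (gen r)) \<cdot> invA ?q \<in> carrier (bestvina_brady G)"
      using v root p by (simp add: BB_carrier_iff raag_height_generator)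
    have "(g \<cdot> gen v) \<cdot> invA (p (ht (g \<cdot> gen v))) = (g \<cdot> gen v) \<cdot> (invA (gen r) \<cdot> invA ?q)"
      using g v root p by (simp add: raag_height_generator p1 A.inv_mult_group)
    also have "\<dots> = g \<cdot> (invA ?q \<cdot> ?q) \<cdot> gen v \<cdot> invA (gen r) \<cdot> invA ?q"
      using g v root p by (simp add: A.m_assoc)
    also have "\<dots> = (g \<cdot> invA ?q) \<cdot> (?q \<cdot> (gen v \<cdot> invA (gen r)) \<cdot> invA ?q)"
      using g v root p by (simp add: A.m_assoc del: A.l_inv)
    finally have "D (g \<cdot> gen v) = D g + \<psi> (?q \<cdot> (gen v \<cdot> invA (gen r)) \<cdot> invA ?q)"
      unfolding D_def using char_mult[OF red[OF g] k] by simp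
    then show ?thesis using char_conj_root[OF v p(1)] by (simp add: x_def)
  qed
  have D: "D (word_class G w) = word_sum x w" if "w \<in> gwords (verts G)" for w
    using that
  proof (induction w rule: rev_induct)
    case Nil
    have "p 0 = \<one>\<^bsub>raag G\<^esub>" by (simp add: p_def)
    then have "D \<one>\<^bsub>raag G\<^esub> = 0" unfolding D_def by (simp add: char_one)
    then show ?case by (simp only: word_class_Nil word_sum.simps)
  next
    case (snoc l w)
    obtain v b where l: "l = (v, b)" by (cases l)
    have w: "w \<in> gwords (verts G)" and v: "v \<in> verts G" using snoc.prems l by auto
    show ?case
    proof (cases b)
      case True
      have "word_class G (w @ [l]) = word_class G w \<cdot> gen v"
        using w v l True by (simp add: raag_generator_def word_class_mult)
      then show ?thesis using step[OF word_class_closed[OF w] v] snoc.IH[OF w] l True by simp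
    next
      case False
      \<comment> \<open>An inverse letter is handled by running \<open>step\<close> backwards:
        multiplication with \<open>gen v\<close> returns to the shorter word.\<close>
      have "(w @ [(v, False), (v, \<not> False)] @ [], w @ []) \<in> pres_rel (verts G) (raag_relators G)"
        by (rule pres_rel.pres_cancel) (use w v in auto)
      then have "word_class G (w @ [l] @ [(v, True)]) = word_class G w"
        using l False by (auto dest: word_class_eqI)
      then have "word_class G (w @ [l]) \<cdot> gen v = word_class G w"
        using snoc.prems v by (simp add: raag_generator_def word_class_mult)
      then show ?thesis
        using step[OF word_class_closed[OF snoc.prems] v] snoc.IH[OF w] l False by simp
    qed
  qed
  have gA: "g \<in> carrier (raag G)" "ht g = 0" using g by (auto simp: BB_carrier_iff)
  have "D g = \<psi> g" using gA by (simp add: D_def p_def)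
  moreover obtain w where "w \<in> gwords (verts G)" "g = word_class G w"
    using gA(1) by (rule raag_carrierE)
  ultimately show ?thesis
    using D[of w] raag_character_class[of w G x] unfolding x_def[abs_def] by simp
qed

end

section \<open>Vertex functions modulo constants as characters of the kernel\<close>

lemma additive_bestvina_brady_character:
  "additive_character (bestvina_brady G) (raag_character x)"
  using additive_raag_character[of G x]
  by (auto simp: additive_character_def BB_carrier_iff)

lemma raag_character_diff:
  assumes "u \<in> verts G" "v \<in> verts G"
  shows "raag_character x (gen u \<cdot> invA (gen v)) = x u - x v"
proof -
  have "raag_character x (gen u \<cdot> invA (gen v)) = raag_character x (gen u) + raag_character x (invA (gen v))"
    using additive_raag_character[of G x] assms unfolding additive_character_def by simp
  then show ?thesis
    using A.additive_character_inv[OF additive_raag_character] assms by (simp add: raag_character_generator)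
qed

text \<open>A constant summand contributes a multiple of the exponent sum, which is zero on the
  kernel.\<close>

lemma raag_character_affine:
  assumes y: "\<And>v. v \<in> verts G \<Longrightarrow> y v = s * x v + t" and g: "g \<in> carrier (bestvina_brady G)"
  shows "raag_character y g = s * raag_character x g"
proof -
  have "word_sum y w = s * word_sum x w + t * exponent_sum w" if "w \<in> gwords (verts G)" for w
    using that by (induction w) (auto simp: y algebra_simps)
  moreover obtain w where w: "w \<in> gwords (verts G)" "g = word_class G w"
    using g by (auto simp: BB_carrier_iff elim: raag_carrierE)
  moreover have "exponent_sum w = 0"
    using g w by (simp add: BB_carrier_iff raag_height_class)
  ultimately show ?thesis by (simp add: raag_character_class)
qed

lemma raag_character_eq_iff:
  "(\<forall>g\<in>carrier (bestvina_brady G). raag_character y g = s * raag_character x g) \<longleftrightarrow>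
   (\<exists>t. \<forall>v\<in>verts G. y v = s * x v + t)" (is "?L \<longleftrightarrow> ?R")
proof
  assume L: ?L
  have "y v = s * x v + (y r - s * x r)" if v: "v \<in> verts G" for v
  proof -
    have "y v - y r = s * (x v - x r)"
      using L gen_diff_closed[OF v root] raag_character_diff[OF v root] by metis
    then show ?thesis by (simp add: algebra_simps)
  qed
  then show ?R by blast
qed (use raag_character_affine in blast)

text \<open>The cochain of the whole group restricts to the kernel. Adding a constant to
  \<open>x\<close> leaves the restricted character unchanged but alters the edge condition, so a
  good choice of constant is part of any application.\<close>

lemma resonant_bestvina_bradyI:
  assumes "\<And>u v. u \<rightarrow>\<^bsub>G\<^esub> v \<Longrightarrow> x u * y v = x v * y u"
    and "\<not> (\<exists>s t. \<forall>v\<in>verts G. y v = s * x v + t)"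
  shows "resonant (bestvina_brady G) (raag_character x)"
proof -
  have "cup_vanishes (raag G) (raag_character x) (raag_character y)"
    by (rule cup_vanishes_raag) (rule assms(1))
  then obtain f where "\<forall>g\<in>carrier (raag G). \<forall>h\<in>carrier (raag G).
      f (g \<cdot> h) = f g + f h + raag_character x g * raag_character y h"
    unfolding cup_vanishes_def by blast
  then have "cup_vanishes (bestvina_brady G) (raag_character x) (raag_character y)"
    unfolding cup_vanishes_def by (intro exI[of _ f]) (simp add: BB_carrier_iff)
  then show ?thesis
    unfolding resonant_def
    using additive_bestvina_brady_character raag_character_eq_iff assms(2) by blast
qed

text \<open>In a triangle the edge differences \<open>gen u \<cdot> invA (gen v)\<close> and
  \<open>gen v \<cdot> invA (gen w)\<close> commute inside the kernel. The resulting equation is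
  collinearity of the three points \<open>(x, y)\<close>.\<close>

lemma resonant_bestvina_bradyD:
  assumes sym: "symmetric G" and res: "resonant (bestvina_brady G) (raag_character x)"
  shows "\<exists>y. (\<forall>u v w. u \<rightarrow>\<^bsub>G\<^esub> v \<longrightarrow> v \<rightarrow>\<^bsub>G\<^esub> w \<longrightarrow> u \<rightarrow>\<^bsub>G\<^esub> w \<longrightarrow>
      (x u - x v) * (y v - y w) = (x v - x w) * (y u - y v)) \<and>
    \<not> (\<exists>s t. \<forall>v\<in>verts G. y v = s * x v + t)"
proof -
  obtain \<beta> where \<beta>: "additive_character (bestvina_brady G) \<beta>"
    and cup: "cup_vanishes (bestvina_brady G) (raag_character x) \<beta>"
    and n: "\<not> (\<exists>c. \<forall>g\<in>carrier (bestvina_brady G). \<beta> g = c * raag_character x g)"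
    using res unfolding resonant_def by blast
  define y where "y v = \<beta> (gen v \<cdot> invA (gen r))" for v
  have \<beta>y: "\<beta> g = raag_character y g" if "g \<in> carrier (bestvina_brady G)" for g
    using char_extends[OF \<beta> that] unfolding y_def .
  have "(x u - x v) * (y v - y w) = (x v - x w) * (y u - y v)"
    if e: "u \<rightarrow>\<^bsub>G\<^esub> v" "v \<rightarrow>\<^bsub>G\<^esub> w" "u \<rightarrow>\<^bsub>G\<^esub> w" for u v w
  proof -
    have V: "u \<in> verts G" "v \<in> verts G" "w \<in> verts G" using adj_verts e by blast+
    let ?a = "gen u \<cdot> invA (gen v)" and ?b = "gen v \<cdot> invA (gen w)"
    have comm: "gen u \<cdot> gen v = gen v \<cdot> gen u" "gen v \<cdot> gen w = gen w \<cdot> gen v" "gen u \<cdot> gen w = gen w \<cdot> gen u"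
      using raag_generators_commute[OF e(1)] raag_generators_commute[OF e(2)]
        raag_generators_commute[OF e(3)] V by simp_all
    have "?a \<cdot> ?b = gen u \<cdot> invA (gen w)"
      using V by (simp add: A.m_assoc)
    moreover have "?b \<cdot> ?a = gen u \<cdot> invA (gen w)"
    proof -
      have "gen v \<cdot> (invA (gen w) \<cdot> gen u) \<cdot> invA (gen v) = gen v \<cdot> (gen u \<cdot> invA (gen w)) \<cdot> invA (gen v)"
        using inv_commutes[of "gen w" "gen u"] comm V by simp
      also have "\<dots> = gen u \<cdot> (gen v \<cdot> invA (gen w)) \<cdot> invA (gen v)"
        using V comm(1) by (simp flip: A.m_assoc)
      also have "gen v \<cdot> invA (gen w) = invA (gen w) \<cdot> gen v"
        using inv_commutes[of "gen w" "gen v"] comm V by simp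
      finally show ?thesis using V by (simp add: A.m_assoc)
    qed
    ultimately have "?a \<cdot> ?b = ?b \<cdot> ?a" by simp
    then have "raag_character x ?a * \<beta> ?b = raag_character x ?b * \<beta> ?a"
      using cup_vanishes_commute[OF cup gen_diff_closed[OF V(1,2)] gen_diff_closed[OF V(2,3)]] by simp
    then show ?thesis
      using V by (simp add: \<beta>y gen_diff_closed raag_character_diff)
  qed
  moreover have "\<not> (\<exists>s t. \<forall>v\<in>verts G. y v = s * x v + t)"
    using n \<beta>y raag_character_affine by metis
  ultimately show ?thesis by blast
qed

end

section \<open>Integer cocycles on simply connected complexes\<close>

text \<open>The winding number of \<open>f\<close> along a null-homotopic loop is zero. The homotopy
  is parametrised by a contractible square, so \<open>f\<close> has a logarithm \<open>G\<close>
  along it. The increment of \<open>G\<close> around the loop does not vary with the stage of the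
  homotopy; it is zero at the constant loop and equals the increment of \<open>g\<close> at
  \<open>p\<close>.\<close>

lemma loop_log_closed:
  fixes f :: "'t::topological_space \<Rightarrow> complex"
  assumes sc: "simply_connected S" and S: "S \<noteq> {}"
    and f: "continuous_on S f" "\<And>x. x \<in> S \<Longrightarrow> f x \<noteq> 0"
    and p: "path p" "path_image p \<subseteq> S" "pathfinish p = pathstart p"
    and g: "path g" "\<And>t. t \<in> {0..1} \<Longrightarrow> f (p t) = exp (g t)"
  shows "pathfinish g = pathstart g"
proof -
  obtain a where a: "a \<in> S" using S by blast
  let ?I = "{0..1::real}"
  have "homotopic_loops S p (\<lambda>_. a)"
  proof (rule sc[unfolded simply_connected_def, rule_format], intro conjI)
    show "path (\<lambda>_::real. a)" by (simp add: path_def)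
    show "path_image (\<lambda>_::real. a) \<subseteq> S" using a by (simp add: path_image_def image_subset_iff)
  qed (use p in \<open>simp_all add: pathfinish_def pathstart_def\<close>)
  then obtain h where h: "continuous_on (?I \<times> ?I) h" "h \<in> ?I \<times> ?I \<rightarrow> S"
    and h0: "\<And>x. x \<in> ?I \<Longrightarrow> h (0, x) = p x" and h1: "\<And>x. x \<in> ?I \<Longrightarrow> h (1, x) = a"
    and hl: "\<And>t. t \<in> ?I \<Longrightarrow> pathfinish (h \<circ> Pair t) = pathstart (h \<circ> Pair t)"
    unfolding homotopic_loops by blast
  have cfh: "continuous_on (?I \<times> ?I) (f \<circ> h)"
    by (rule continuous_on_compose[OF h(1) continuous_on_subset[OF f(1)]]) (use h(2) in auto)
  have "contractible (?I \<times> ?I)"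
    by (intro convex_imp_contractible convex_Times) auto
  then obtain G where G: "continuous_on (?I \<times> ?I) G"
      "\<And>x. x \<in> ?I \<times> ?I \<Longrightarrow> (f \<circ> h) x = exp (G x)"
  proof (rule continuous_logarithm_on_contractible[OF cfh])
    show "(f \<circ> h) z \<noteq> 0" if "z \<in> ?I \<times> ?I" for z
      using h(2) f(2) that by (auto simp: Pi_iff)
  qed blast
  \<comment> \<open>Logarithms of 1 form the discrete set of integer multiples of
    \<open>2 * pi * \<i>\<close>, so a continuous choice on an interval is constant.\<close>
  have const: "\<phi> constant_on ?I"
    if c: "continuous_on ?I \<phi>" and e: "\<And>t. t \<in> ?I \<Longrightarrow> exp (\<phi> t) = (1::complex)" for \<phi>
  proof (rule continuous_discrete_range_constant[OF _ c])
    show "Topological_Spaces.connected ?I" by simp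
    fix x assume x: "x \<in> ?I"
    show "\<exists>e>0. \<forall>y. y \<in> ?I \<and> \<phi> y \<noteq> \<phi> x \<longrightarrow> e \<le> norm (\<phi> y - \<phi> x)"
    proof (intro exI[of _ "2 * pi"] conjI allI impI)
      fix y assume y: "y \<in> ?I \<and> \<phi> y \<noteq> \<phi> x"
      have "exp (\<phi> y - \<phi> x) = 1" using e x y by (simp add: exp_diff)
      then obtain n :: int where n: "Re (\<phi> y - \<phi> x) = 0" "Im (\<phi> y - \<phi> x) = of_int (2 * n) * pi"
        unfolding exp_eq_1 by blast
      have "n \<noteq> 0" using n y by (auto simp: complex_eq_iff)
      then have "\<bar>of_int (2 * n) * pi\<bar> \<ge> 2 * pi"
        by (simp add: abs_mult)
      then show "2 * pi \<le> norm (\<phi> y - \<phi> x)"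
        using abs_Im_le_cmod[of "\<phi> y - \<phi> x"] n by simp
    qed simp
  qed
  have "(\<lambda>t. G (t, 1) - G (t, 0)) constant_on ?I"
  proof (rule const)
    show "continuous_on ?I (\<lambda>t. G (t, 1) - G (t, 0))"
      by (intro continuous_intros continuous_on_compose2[OF G(1)]) auto
    show "exp (G (t, 1) - G (t, 0)) = 1" if t: "t \<in> ?I" for t
      using hl[OF t] G(2)[of "(t, 1)"] G(2)[of "(t, 0)"] t
      by (simp add: exp_diff pathfinish_def pathstart_def)
  qed
  then have 1: "G (0, 1) - G (0, 0) = G (1, 1) - G (1, 0)"
    unfolding constant_on_def by (metis atLeastAtMost_iff order_refl zero_le_one)
  have "(\<lambda>t. G (1, t) - G (1, 0)) constant_on ?I"
  proof (rule const)
    show "continuous_on ?I (\<lambda>t. G (1, t) - G (1, 0))"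
      by (intro continuous_intros continuous_on_compose2[OF G(1)]) auto
    show "exp (G (1, t) - G (1, 0)) = 1" if t: "t \<in> ?I" for t
      using h1[OF t] h1[of 0] G(2)[of "(1, t)"] G(2)[of "(1, 0)"] t
      by (simp add: exp_diff)
  qed
  then have 2: "G (1, 1) - G (1, 0) = 0"
    unfolding constant_on_def by (metis atLeastAtMost_iff order_refl zero_le_one diff_self)
  have "(\<lambda>t. G (0, t) - g t) constant_on ?I"
  proof (rule const)
    show "continuous_on ?I (\<lambda>t. G (0, t) - g t)"
      using g(1) unfolding path_def
      by (intro continuous_intros continuous_on_compose2[OF G(1)]) auto
    show "exp (G (0, t) - g t) = 1" if t: "t \<in> ?I" for t
      using h0[OF t] g(2)[OF t] G(2)[of "(0, t)"] t
      by (simp add: exp_diff)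
  qed
  then have "G (0, 1) - g 1 = G (0, 0) - g 0"
    unfolding constant_on_def by (metis atLeastAtMost_iff order_refl zero_le_one)
  then show ?thesis using 1 2 by (simp add: pathfinish_def pathstart_def)
qed

text \<open>The cocycle identity includes repeated vertices, which encodes \<open>c u u = 0\<close>
  and \<open>c v u = - c u v\<close> on simplices.\<close>

locale integer_cocycle =
  fixes K :: "'a set set" and V :: "'a set" and c :: "'a \<Rightarrow> 'a \<Rightarrow> int"
  assumes finV: "finite V"
    and simplex_subset: "S \<in> K \<Longrightarrow> S \<subseteq> V"
    and face: "S \<in> K \<Longrightarrow> T \<subseteq> S \<Longrightarrow> T \<noteq> {} \<Longrightarrow> T \<in> K"
    and cocycle: "S \<in> K \<Longrightarrow> u \<in> S \<Longrightarrow> v \<in> S \<Longrightarrow> w \<in> S \<Longrightarrow> c u v + c v w = c u w"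
begin

text \<open>The map to the circle that represents the class of \<open>c\<close>. On the open star of
  \<open>v\<close> the exponential for \<open>v\<close> alone would do; averaging with barycentric
  weights gives one formula that is evidently continuous.\<close>

definition circle_map :: "('a \<Rightarrow> real) \<Rightarrow> complex" where
  "circle_map x = (\<Sum>v\<in>V. of_real (x v) * exp (2 * pi * \<i> * (\<Sum>u\<in>V. of_real (x u) * of_int (c v u))))"

lemma sum_barycentric:
  assumes "x \<in> geometric_realization K"
  shows "(\<Sum>v\<in>V. x v) = 1"
proof -
  have "{v. x v \<noteq> 0} \<in> K" and 1: "(\<Sum>v | x v \<noteq> 0. x v) = 1"
    using assms by (auto simp: geometric_realization_def)
  then have "{v. x v \<noteq> 0} \<subseteq> V" using simplex_subset by blast
  then have "(\<Sum>v | x v \<noteq> 0. x v) = (\<Sum>v\<in>V. x v)"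
    by (intro sum.mono_neutral_left finV) auto
  then show ?thesis using 1 by simp
qed

text \<open>On a simplex, two of the exponents in \<open>circle_map\<close> differ by an integer multiple of \<open>2 * pi * \<i>\<close>.\<close>

lemma circle_map_eq:
  assumes x: "x \<in> geometric_realization K" and v: "x v \<noteq> 0"
  shows "circle_map x = exp (2 * pi * \<i> * (\<Sum>u\<in>V. of_real (x u) * of_int (c v u)))"
proof -
  let ?S = "{v. x v \<noteq> 0}"
  let ?th = "\<lambda>v. \<Sum>u\<in>V. complex_of_real (x u) * of_int (c v u)"
  have S: "?S \<in> K" using x by (auto simp: geometric_realization_def)
  have e: "exp (2 * pi * \<i> * ?th w) = exp (2 * pi * \<i> * ?th v)" if w: "x w \<noteq> 0" for w
  proof -
    have "?th w = (\<Sum>u\<in>V. of_real (x u) * of_int (c v u) + of_real (x u) * of_int (c w v))"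
    proof (rule sum.cong[OF refl])
      fix u
      show "complex_of_real (x u) * of_int (c w u) = of_real (x u) * of_int (c v u) + of_real (x u) * of_int (c w v)"
        using cocycle[OF S, of w v u] v w
        by (cases "x u = 0") (auto simp: distrib_left[symmetric] add.commute simp flip: of_int_add)
    qed
    also have "\<dots> = ?th v + of_real (\<Sum>u\<in>V. x u) * of_int (c w v)"
      by (simp add: sum.distrib sum_distrib_right)
    finally have "?th w = ?th v + of_int (c w v)" by (simp add: sum_barycentric[OF x])
    then have "2 * pi * \<i> * ?th w = 2 * pi * \<i> * ?th v + (of_int (2 * c w v) * pi) * \<i>"
      by (simp add: algebra_simps)
    then show ?thesis unfolding exp_eq by blast
  qed
  have "circle_map x = (\<Sum>w\<in>V. of_real (x w) * exp (2 * pi * \<i> * ?th v))"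
    unfolding circle_map_def
  proof (rule sum.cong[OF refl])
    fix w
    show "complex_of_real (x w) * exp (2 * pi * \<i> * ?th w) = of_real (x w) * exp (2 * pi * \<i> * ?th v)"
      using e[of w] by (cases "x w = 0") auto
  qed
  also have "\<dots> = of_real (\<Sum>w\<in>V. x w) * exp (2 * pi * \<i> * ?th v)"
    by (simp add: sum_distrib_right)
  finally show ?thesis by (simp add: sum_barycentric[OF x])
qed

lemma continuous_circle_map: "continuous_on A circle_map"
proof -
  have *: "continuous_on A (\<lambda>x. x v)" for v :: 'a
    by (rule continuous_on_subset[OF continuous_on_product_coordinates]) simp
  show ?thesis
    unfolding circle_map_def by (intro continuous_on_sum continuous_on_mult continuous_on_exp continuous_on_of_real continuous_on_const *)
qed

section \<open>Lifting the circle map along edge paths\<close>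

definition vertex_point :: "'a \<Rightarrow> 'a \<Rightarrow> real" where
  "vertex_point v = (\<lambda>w. if w = v then 1 else 0)"

definition edge_path :: "'a \<Rightarrow> 'a \<Rightarrow> real \<Rightarrow> 'a \<Rightarrow> real" where
  "edge_path u v t = (\<lambda>w. (1 - t) * vertex_point u w + t * vertex_point v w)"

lemma edge_path_in:
  assumes "{u, v} \<in> K" "t \<in> {0..1}"
  shows "edge_path u v t \<in> geometric_realization K"
proof -
  let ?x = "edge_path u v t"
  have supp: "{w. ?x w \<noteq> 0} \<subseteq> {u, v}"
    by (auto simp: edge_path_def vertex_point_def)
  have ne: "{w. ?x w \<noteq> 0} \<noteq> {}"
  proof -
    have "?x u \<noteq> 0 \<or> ?x v \<noteq> 0"
      by (auto simp: edge_path_def vertex_point_def)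
    then show ?thesis by auto
  qed
  have "(\<Sum>w | ?x w \<noteq> 0. ?x w) = (\<Sum>w\<in>{u, v}. ?x w)"
    by (intro sum.mono_neutral_left) (use supp in auto)
  also have "\<dots> = 1" by (cases "u = v") (auto simp: edge_path_def vertex_point_def)
  finally show ?thesis
    using face[OF assms(1) supp ne] assms(2)
    by (auto simp: geometric_realization_def edge_path_def vertex_point_def)
qed

lemma circle_map_edge_path:
  assumes uv: "{u, v} \<in> K" and t: "t \<in> {0..1}"
  shows "circle_map (edge_path u v t) = exp (2 * pi * \<i> * of_real t * of_int (c u v))"
proof -
  let ?x = "edge_path u v t"
  have V: "u \<in> V" "v \<in> V" using simplex_subset[OF uv] by auto
  have cuu: "c w w = 0" if "w \<in> {u, v}" for w using cocycle[OF uv that that that] by simp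
  have cvu: "c v u = - c u v" using cocycle[OF uv, of u v u] cuu[of u] by simp
  have val: "(\<Sum>w\<in>V. complex_of_real (?x w) * of_int (c z w))
     = of_real (1 - t) * of_int (c z u) + of_real t * of_int (c z v)" for z
  proof -
    have "(\<Sum>w\<in>V. complex_of_real (?x w) * of_int (c z w))
      = (\<Sum>w\<in>V. if w = u then of_real (1 - t) * of_int (c z u) else 0)
        + (\<Sum>w\<in>V. if w = v then of_real t * of_int (c z v) else 0)"
      unfolding sum.distrib[symmetric]
      by (rule sum.cong) (auto simp: edge_path_def vertex_point_def algebra_simps)
    then show ?thesis using V finV by simp
  qed
  show ?thesis
  proof (cases "?x u = 0")
    case False
    then show ?thesis
      using circle_map_eq[OF edge_path_in[OF uv t] False] cuu[of u]
      unfolding val by (simp add: algebra_simps)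
  next
    case True
    \<comment> \<open>The endpoint has left the open star of \<open>u\<close>, so the value is read
      off at \<open>v\<close>, where both sides are 1.\<close>
    then have "t = 1" "u \<noteq> v" "?x v \<noteq> 0"
      by (auto simp: edge_path_def vertex_point_def split: if_splits)
    then have "circle_map ?x = 1"
      using circle_map_eq[OF edge_path_in[OF uv t], of v] cuu[of v]
      unfolding val by simp
    moreover have "exp (2 * pi * \<i> * of_real t * of_int (c u v)) = 1"
      using \<open>t = 1\<close> unfolding exp_eq_1 by (auto intro!: exI[of _ "c u v"])
    ultimately show ?thesis by simp
  qed
qed

lemma path_edge_path: "path (edge_path u v)"
  unfolding path_def
proof (rule continuous_on_coordinatewise_then_product)
  show "continuous_on {0..1} (\<lambda>t. edge_path u v t w)" for w
    unfolding edge_path_def by (intro continuous_intros)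
qed

lemma edge_path_ends [simp]:
  "pathstart (edge_path u v) = vertex_point u" "pathfinish (edge_path u v) = vertex_point v"
  by (auto simp: edge_path_def pathstart_def pathfinish_def)

text \<open>The number of turns of \<open>circle_map\<close> along some path from \<open>r\<close>
  to \<open>v\<close>, read off from a logarithm. It is a relation because different paths could
  give different numbers; simple connectivity excludes this and turns it into the potential of
  \<open>c\<close>.\<close>

definition lifted_height :: "'a \<Rightarrow> 'a \<Rightarrow> int \<Rightarrow> bool" where
  "lifted_height r v n \<longleftrightarrow> (\<exists>p g. path p \<and> path_image p \<subseteq> geometric_realization K
     \<and> pathstart p = vertex_point r \<and> pathfinish p = vertex_point v
     \<and> path g \<and> pathstart g = 0 \<and> pathfinish g = 2 * pi * \<i> * of_int n
     \<and> (\<forall>t\<in>{0..1}. circle_map (p t) = exp (g t)))"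

lemma lifted_height_refl:
  assumes "{r} \<in> K"
  shows "lifted_height r r 0"
proof -
  have rr: "{r, r} \<in> K" using assms by simp
  have "c r r = 0" using cocycle[OF rr, of r r r] by simp
  then show ?thesis
    unfolding lifted_height_def using edge_path_in[OF rr] circle_map_edge_path[OF rr]
    by (intro exI[of _ "edge_path r r"] exI[of _ "\<lambda>_. 0"])
       (auto simp: path_edge_path path_image_def pathstart_def pathfinish_def edge_path_def intro: path_const)
qed

lemma lifted_height_step:
  assumes h: "lifted_height r u n" and uv: "{u, v} \<in> K"
  shows "lifted_height r v (n + c u v)"
proof -
  obtain p g where p: "path p" "path_image p \<subseteq> geometric_realization K"
      "pathstart p = vertex_point r" "pathfinish p = vertex_point u"
    and g: "path g" "pathstart g = 0" "pathfinish g = 2 * pi * \<i> * of_int n"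
    and pg: "\<And>t. t \<in> {0..1} \<Longrightarrow> circle_map (p t) = exp (g t)"
    using h unfolding lifted_height_def by blast
  define g' where "g' = (\<lambda>t. 2 * pi * \<i> * of_int n + 2 * pi * \<i> * of_real t * of_int (c u v))"
  have g': "path g'" "pathstart g' = pathfinish g" "pathfinish g' = 2 * pi * \<i> * of_int (n + c u v)"
    using g by (auto simp: g'_def path_def pathstart_def pathfinish_def algebra_simps intro!: continuous_intros)
  have en: "exp (2 * pi * \<i> * of_int n) = 1"
    unfolding exp_eq_1 by (auto intro!: exI[of _ n])
  have eg': "circle_map (edge_path u v t) = exp (g' t)" if "t \<in> {0..1}" for t
    using circle_map_edge_path[OF uv that] en by (simp add: g'_def exp_add)
  have im: "path_image (edge_path u v) \<subseteq> geometric_realization K"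
    using edge_path_in[OF uv] by (auto simp: path_image_def)
  show ?thesis unfolding lifted_height_def
  proof (intro exI[of _ "p +++ edge_path u v"] exI[of _ "g +++ g'"] conjI ballI)
    show "path_image (p +++ edge_path u v) \<subseteq> geometric_realization K"
      using im p path_image_join_subset by blast
    show "circle_map ((p +++ edge_path u v) t) = exp ((g +++ g') t)" if "t \<in> {0..1}" for t
      using that pg[of "2 * t"] eg'[of "2 * t - 1"] by (auto simp: joinpaths_def)
  qed (use p g g' in \<open>auto simp: path_edge_path\<close>)
qed

lemma lifted_height_unique:
  assumes sc: "simply_connected (geometric_realization K)"
    and "lifted_height r v m" "lifted_height r v n"
  shows "m = n"
proof -
  obtain p g where p: "path p" "path_image p \<subseteq> geometric_realization K"
      "pathstart p = vertex_point r" "pathfinish p = vertex_point v"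
    and g: "path g" "pathstart g = 0" "pathfinish g = 2 * pi * \<i> * of_int m"
    and pg: "\<And>t. t \<in> {0..1} \<Longrightarrow> circle_map (p t) = exp (g t)"
    using assms(2) unfolding lifted_height_def by blast
  obtain q h where q: "path q" "path_image q \<subseteq> geometric_realization K"
      "pathstart q = vertex_point r" "pathfinish q = vertex_point v"
    and h: "path h" "pathstart h = 0" "pathfinish h = 2 * pi * \<i> * of_int n"
    and qh: "\<And>t. t \<in> {0..1} \<Longrightarrow> circle_map (q t) = exp (h t)"
    using assms(3) unfolding lifted_height_def by blast
  \<comment> \<open>The reversed logarithm of the second path is shifted to start where
    \<open>g\<close> ends. The joined loop then has total increment
    \<open>2 * pi * \<i> * of_int (m - n)\<close>.\<close>
  define k where "k = (\<lambda>t. reversepath h t + 2 * pi * \<i> * of_int (m - n))"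
  have k: "path k" "pathstart k = pathfinish g" "pathfinish k = 2 * pi * \<i> * of_int (m - n)"
    using h g path_reversepath[of h]
    by (auto simp: k_def path_def pathstart_def pathfinish_def reversepath_def algebra_simps intro!: continuous_intros)
  have e: "exp (2 * pi * \<i> * of_int (m - n)) = 1"
    unfolding exp_eq_1 by (auto intro!: exI[of _ "m - n"])
  have ek: "circle_map (reversepath q t) = exp (k t)" if "t \<in> {0..1}" for t
    using that qh[of "1 - t"] e by (simp add: k_def reversepath_def exp_add)
  have "pathfinish (g +++ k) = pathstart (g +++ k)"
  proof (rule loop_log_closed[OF sc _ continuous_circle_map])
    show "geometric_realization K \<noteq> {}" using p(2) path_image_nonempty by blast
    show "circle_map x \<noteq> 0" if "x \<in> geometric_realization K" for x
    proof -
      have "(\<Sum>v\<in>V. x v) \<noteq> 0" using sum_barycentric[OF that] by simp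
      then obtain v where "x v \<noteq> 0" by (meson sum.neutral)
      then show ?thesis using circle_map_eq[OF that] by simp
    qed
    show "path_image (p +++ reversepath q) \<subseteq> geometric_realization K"
      using p q path_image_join_subset[of p "reversepath q"] by auto
    show "circle_map ((p +++ reversepath q) t) = exp ((g +++ k) t)" if "t \<in> {0..1}" for t
      using that pg[of "2 * t"] ek[of "2 * t - 1"] by (auto simp: joinpaths_def)
  qed (use p q g k in auto)
  then show ?thesis using g k by simp
qed

lemma cocycle_is_coboundary:
  assumes sc: "simply_connected (geometric_realization K)"
    and reach: "\<And>v. v \<in> V \<Longrightarrow> (r, v) \<in> {(u, v). {u, v} \<in> K}\<^sup>*"
    and r: "{r} \<in> K"
  shows "\<exists>\<gamma>. \<forall>u v. {u, v} \<in> K \<longrightarrow> c u v = \<gamma> v - \<gamma> u"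
proof -
  have ex: "\<exists>n. lifted_height r v n" if "v \<in> V" for v
    using reach[OF that]
  proof induction
    case base
    then show ?case using lifted_height_refl[OF r] by blast
  next
    case (step u v)
    then show ?case using lifted_height_step by blast
  qed
  show ?thesis
  proof (intro exI[of _ "\<lambda>v. THE n. lifted_height r v n"] allI impI)
    fix u v assume uv: "{u, v} \<in> K"
    obtain m where m: "lifted_height r u m" using ex simplex_subset[OF uv] by blast
    then have "lifted_height r v (m + c u v)" using lifted_height_step uv by blast
    moreover have "(THE n. lifted_height r w n) = n" if "lifted_height r w n" for w n
      using that lifted_height_unique[OF sc] by blast
    ultimately show "c u v = (THE n. lifted_height r v n) - (THE n. lifted_height r u n)"
      using m by simp
  qed
qed

end

section \<open>Separating vertex sets\<close>

definition vertex_split :: "('a,'b) pre_digraph \<Rightarrow> 'a set \<Rightarrow> 'a set \<Rightarrow> 'a set \<Rightarrow> bool" where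
  "vertex_split G S P Q \<longleftrightarrow> P \<union> Q = S \<and> P \<inter> Q = {} \<and> P \<noteq> {} \<and> Q \<noteq> {} \<and>
     (\<forall>u\<in>P. \<forall>v\<in>Q. \<not> u \<rightarrow>\<^bsub>G\<^esub> v)"

definition separating_set :: "('a,'b) pre_digraph \<Rightarrow> 'a set \<Rightarrow> bool" where
  "separating_set G N \<longleftrightarrow> N \<subseteq> verts G \<and> (\<exists>P Q. vertex_split G (verts G - N) P Q)"

lemma arcs_ends_induce:
  "arcs_ends (G \<restriction> S) = {(u, v). u \<rightarrow>\<^bsub>G\<^esub> v \<and> u \<in> S \<and> v \<in> S}"
  by (auto simp: arcs_ends_conv)

lemma symcl_symmetric: "symmetric G \<Longrightarrow> (arcs_ends G)\<^sup>s = arcs_ends G"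
  by (auto simp: symcl_def symmetric_def sym_def)

lemma symmetric_induce: "symmetric G \<Longrightarrow> symmetric (G \<restriction> S)"
  unfolding symmetric_def arcs_ends_induce by (auto simp: sym_def)

lemma disconnected_induce_iff:
  assumes "symmetric G"
  shows "disconnected (G \<restriction> S) \<longleftrightarrow> (\<exists>P Q. vertex_split G S P Q)"
proof -
  let ?R = "rtrancl_on S (arcs_ends (G \<restriction> S))"
  have conn: "Digraph_Component.connected (G \<restriction> S) \<longleftrightarrow> S \<noteq> {} \<and> (\<forall>u\<in>S. \<forall>v\<in>S. (u, v) \<in> ?R)"
    by (simp add: connected_conv symcl_symmetric[OF symmetric_induce[OF assms]])
  show ?thesis
  proof
    assume "disconnected (G \<restriction> S)"
    then obtain u v where uv: "u \<in> S" "v \<in> S" "(u, v) \<notin> ?R"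
      unfolding disconnected_def conn by auto
    have "vertex_split G S {w \<in> S. (u, w) \<in> ?R} {w \<in> S. (u, w) \<notin> ?R}"
      unfolding vertex_split_def using uv
      by (auto simp: arcs_ends_induce intro: rtrancl_on.intros)
    then show "\<exists>P Q. vertex_split G S P Q" by blast
  next
    assume "\<exists>P Q. vertex_split G S P Q"
    then obtain P Q p q where PQ: "vertex_split G S P Q" and p: "p \<in> P" and q: "q \<in> Q"
      unfolding vertex_split_def by blast
    have "u \<in> P \<longrightarrow> v \<in> P" if "(u, v) \<in> ?R" for u v
      using that
      by induction (use PQ in \<open>auto simp: vertex_split_def arcs_ends_induce\<close>)
    then have "v \<in> P" if "(p, v) \<in> ?R" for v using that p by blast
    then have "(p, q) \<notin> ?R" using PQ q by (auto simp: vertex_split_def)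
    then show "disconnected (G \<restriction> S)"
      using PQ p q unfolding disconnected_def conn by (auto simp: vertex_split_def)
  qed
qed

lemma connected_rtrancl:
  assumes "symmetric G" "Digraph_Component.connected G" "u \<in> verts G" "v \<in> verts G"
  shows "(u, v) \<in> (arcs_ends G)\<^sup>*"
proof -
  have "(u, v) \<in> rtrancl_on (verts G) (arcs_ends G)"
    using assms by (simp add: connected_conv symcl_symmetric)
  then show ?thesis by (induction rule: rtrancl_on.induct) (auto intro: rtrancl_into_rtrancl)
qed

text \<open>Each proper subset of the vertices of \<open>L\<close> spans a proper full subgraph, so
  minimality passes from full subgraphs to vertex sets.\<close>

lemma minimal_full_separating_subgraphD:
  assumes G: "graph G" and L: "minimal_full_separating_subgraph L G"
  shows "separating_set G (verts L)"
    and "N \<subset> verts L \<Longrightarrow> \<not> separating_set G N"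
proof -
  interpret graph G by (rule G)
  have LG: "subgraph L G" and dis: "disconnected (G \<restriction> (verts G - verts L))"
    using L by (auto simp: minimal_full_separating_subgraph_def separating_subgraph_def)
  then have VL: "verts L \<subseteq> verts G" by blast
  then show "separating_set G (verts L)"
    using dis unfolding separating_set_def disconnected_induce_iff[OF sym_arcs] by blast
  show "\<not> separating_set G N" if N: "N \<subset> verts L"
  proof
    assume sep: "separating_set G N"
    have wfL: "wf_digraph L" using LG by blast
    have i: "induced_subgraph (L \<restriction> N) L" using wf_digraph.induced_induce[OF wfL] N by blast
    have "L \<restriction> N \<noteq> L" using N induce_subgraph_verts by (metis less_irrefl)
    then have "\<not> separating_subgraph (L \<restriction> N) G"
      using L i unfolding minimal_full_separating_subgraph_def by blast
    moreover have "subgraph (L \<restriction> N) G" using i LG subgraph_trans by blast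
    ultimately have "\<not> disconnected (G \<restriction> (verts G - N))"
      unfolding separating_subgraph_def by simp
    then show False
      using sep unfolding separating_set_def disconnected_induce_iff[OF sym_arcs] by blast
  qed
qed

text \<open>An empty separating set contradicts connectedness, and a separating singleton is a cut
  vertex.\<close>

lemma biconnected_separating_set:
  assumes G: "graph G" and b: "biconnected G" and N: "separating_set G N"
  shows "\<exists>u\<in>N. \<exists>v\<in>N. u \<noteq> v"
proof (rule ccontr)
  assume c: "\<not> ?thesis"
  interpret graph G by (rule G)
  have dis: "disconnected (G \<restriction> (verts G - N))"
    using N unfolding separating_set_def disconnected_induce_iff[OF sym_arcs] by blast
  have full: "G \<restriction> verts G = G" by (rule induce_eq_iff_induced) (rule induced_subgraph_refl)
  show False
  proof (cases "N = {}")
    case True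
    then show False using dis b full by (simp add: biconnected_def disconnected_def)
  next
    case False
    then obtain v where v: "N = {v}" using c by blast
    have "G \<restriction> (verts G - {v}) = pre_digraph.del_vert G v"
      unfolding pre_digraph.del_vert_def induce_subgraph_def by (auto intro: wellformed)
    then have "cut_vertex G v"
      using dis N v by (auto simp: cut_vertex_def separating_set_def)
    then show False using b by (auto simp: biconnected_def)
  qed
qed

section \<open>Resonance of Bestvina--Brady groups\<close>

lemma edge_in_flag_complex:
  assumes "symmetric G" "u \<in> verts G" "v \<in> verts G" "u = v \<or> u \<rightarrow>\<^bsub>G\<^esub> v"
  shows "{u, v} \<in> flag_complex G"
  using assms arcs_ends_symmetric[OF assms(1)] by (auto simp: flag_complex_def)

text \<open>
  The points \<open>(x v, y v)\<close> map the flag complex to a union of segments in the plane. For a component \<open>C\<close> of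
  the preimage of one line, the cocycle counting how often a path inside \<open>C\<close> crosses a level of \<open>x\<close> is
  a coboundary, so the complement of \<open>C\<close> can only be attached to \<open>C\<close> along a single level of \<open>x\<close>.
\<close>

lemma level_set_separates:
  fixes x y :: "'a \<Rightarrow> real"
  assumes G: "graph G" and conn: "Digraph_Component.connected G"
    and sc: "simply_connected (geometric_realization (flag_complex G))"
    and collinear: "\<And>u v w. u \<rightarrow>\<^bsub>G\<^esub> v \<Longrightarrow> v \<rightarrow>\<^bsub>G\<^esub> w \<Longrightarrow> u \<rightarrow>\<^bsub>G\<^esub> w \<Longrightarrow>
        (x u - x v) * (y v - y w) = (x v - x w) * (y u - y v)"
    and y: "\<not> (\<exists>s t. \<forall>v\<in>verts G. y v = s * x v + t)"
    and x: "\<not> (\<exists>k. \<forall>v\<in>verts G. x v = k)"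
  shows "\<exists>N k. separating_set G N \<and> (\<forall>v\<in>N. x v = k)"
proof -
  interpret graph G by (rule G)
  let ?V = "verts G"
  have symm: "v \<rightarrow>\<^bsub>G\<^esub> u" if "u \<rightarrow>\<^bsub>G\<^esub> v" for u v using arcs_ends_symmetric[OF sym_arcs that] .
  obtain r where r: "r \<in> ?V" using x by auto
  have reach: "(r, v) \<in> (arcs_ends G)\<^sup>*" if "v \<in> ?V" for v
    using connected_rtrancl[OF sym_arcs conn r that] .
  have "\<exists>u v. u \<rightarrow>\<^bsub>G\<^esub> v \<and> x u \<noteq> x v"
  proof (rule ccontr)
    assume c: "\<not> ?thesis"
    have "x v = x r" if "v \<in> ?V" for v
      using reach[OF that] by induction (use c in auto)
    with x show False by blast
  qed
  then obtain a b where ab: "a \<rightarrow>\<^bsub>G\<^esub> b" "x a \<noteq> x b" by blast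
  then have abV: "a \<in> ?V" "b \<in> ?V" by (auto dest: adj_in_verts)
  \<comment> \<open>The line \<open>y = s * x + t\<close> passes through the images of
    \<open>a\<close> and \<open>b\<close>; \<open>off\<close> is the vertical distance from
    it.\<close>
  define s where "s = (y b - y a) / (x b - x a)"
  define t where "t = y a - s * x a"
  define off where "off v = y v - s * x v - t" for v
  have "s * (x b - x a) = y b - y a" using ab by (simp add: s_def)
  then have off_ab: "off a = 0" "off b = 0" by (auto simp: off_def t_def algebra_simps)
  obtain z where z: "z \<in> ?V" "off z \<noteq> 0"
  proof -
    have "\<exists>v\<in>?V. y v \<noteq> s * x v + t" using y by blast
    then show ?thesis using that by (auto simp: off_def)
  qed
  \<comment> \<open>\<open>C\<close> is the component of \<open>a\<close> among the vertices on the
    line. Below, \<open>K\<close> is the component of \<open>z\<close> in the complement of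
    \<open>C\<close>, and \<open>N\<close> is the part of \<open>C\<close> to which \<open>K\<close>
    is attached.\<close>
  define C where "C = {v. (a, v) \<in> {(u, v). u \<rightarrow>\<^bsub>G\<^esub> v \<and> off v = 0}\<^sup>*}"
  have aC: "a \<in> C" by (simp add: C_def)
  have Cstep: "v \<in> C" if "u \<in> C" "u \<rightarrow>\<^bsub>G\<^esub> v" "off v = 0" for u v
    using that unfolding C_def by (auto intro: rtrancl_into_rtrancl)
  have bC: "b \<in> C" using Cstep aC ab off_ab by blast
  have CL: "off v = 0 \<and> v \<in> ?V" if "v \<in> C" for v
    using that unfolding C_def mem_Collect_eq
    by induction (use off_ab abV in \<open>auto dest: adj_in_verts\<close>)
  define K where "K = {v. (z, v) \<in> {(u, v). u \<rightarrow>\<^bsub>G\<^esub> v \<and> v \<notin> C}\<^sup>*}"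
  have zK: "z \<in> K" by (simp add: K_def)
  have Kstep: "v \<in> K" if "u \<in> K" "u \<rightarrow>\<^bsub>G\<^esub> v" "v \<notin> C" for u v
    using that unfolding K_def by (auto intro: rtrancl_into_rtrancl)
  have KM: "v \<in> ?V \<and> v \<notin> C" if "v \<in> K" for v
    using that unfolding K_def mem_Collect_eq
    by induction (use z CL in \<open>auto dest: adj_in_verts\<close>)
  define N where "N = {n \<in> C. \<exists>k\<in>K. k \<rightarrow>\<^bsub>G\<^esub> n}"
  \<comment> \<open>A neighbour \<open>w\<close> of \<open>C\<close> outside \<open>C\<close> is off
    the line. Being collinear with the images of \<open>u\<close> and \<open>v\<close> on the line,
    it forces these images to coincide.\<close>
  have attach: "x u = x v"
    if S: "S \<in> flag_complex G" "u \<in> S" "v \<in> S" "w \<in> S" and C: "u \<in> C" "v \<in> C" "w \<notin> C" for S u v w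
  proof (cases "u = v")
    case False
    have e: "u \<rightarrow>\<^bsub>G\<^esub> v" "v \<rightarrow>\<^bsub>G\<^esub> w" "u \<rightarrow>\<^bsub>G\<^esub> w"
      using S C False unfolding flag_complex_def by auto
    have "off w \<noteq> 0" using Cstep[OF C(1) e(3)] C by blast
    have lv: "y u = s * x u + t" "y v = s * x v + t" "y w = s * x w + t + off w"
      using CL[OF C(1)] CL[OF C(2)] by (auto simp: off_def)
    have "off w * (x u - x v) = 0"
      using collinear[OF e] unfolding lv by (auto simp: algebra_simps)
    then show ?thesis using \<open>off w \<noteq> 0\<close> by simp
  qed simp
  have const: "x m \<le> x n" if mn: "m \<in> N" "n \<in> N" for m n
  proof (rule ccontr)
    assume lt: "\<not> x m \<le> x n"
    \<comment> \<open>\<open>h\<close> is a threshold separating \<open>x m\<close> from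
      \<open>x n\<close>. By \<open>attach\<close> its increments vanish on every simplex that
      leaves \<open>C\<close>, so cutting them off outside \<open>C\<close> still gives a
      cocycle.\<close>
    define h :: "'a \<Rightarrow> int" where "h v = (if x v > x n then 1 else 0)" for v
    define c where "c u v = (if u \<in> C \<and> v \<in> C then h v - h u else 0)" for u v
    interpret integer_cocycle "flag_complex G" ?V c
    proof
      show "S \<subseteq> ?V" if "S \<in> flag_complex G" for S using that by (simp add: flag_complex_def)
      show "T \<in> flag_complex G" if "S \<in> flag_complex G" "T \<subseteq> S" "T \<noteq> {}" for S T
        using that unfolding flag_complex_def by (auto dest: subsetD)
      show "c u v + c v w = c u w" if S: "S \<in> flag_complex G" "u \<in> S" "v \<in> S" "w \<in> S" for S u v w
        using attach[OF S(1,2,3,4)] attach[OF S(1,2,4,3)] attach[OF S(1,3,4,2)]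
        by (auto simp: c_def h_def)
    qed simp
    have "\<exists>\<gamma>. \<forall>u v. {u, v} \<in> flag_complex G \<longrightarrow> c u v = \<gamma> v - \<gamma> u"
    proof (rule cocycle_is_coboundary[OF sc])
      show "(r, v) \<in> {(u, v). {u, v} \<in> flag_complex G}\<^sup>*" if "v \<in> ?V" for v
      proof (rule rtrancl_mono[THEN subsetD, OF _ reach[OF that]])
        show "arcs_ends G \<subseteq> {(u, v). {u, v} \<in> flag_complex G}"
          using adj_in_verts by (auto intro!: edge_in_flag_complex[OF sym_arcs])
      qed
      show "{r} \<in> flag_complex G" using r by (simp add: flag_complex_def)
    qed
    then obtain \<gamma> where \<gamma>: "c u v = \<gamma> v - \<gamma> u" if "u \<rightarrow>\<^bsub>G\<^esub> v" for u v
      using edge_in_flag_complex[OF sym_arcs] adj_in_verts by metis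
    \<comment> \<open>Edges not inside \<open>C\<close> carry the value zero, so
      \<open>\<gamma>\<close> is constant on \<open>K\<close> and hence on \<open>N\<close>. On
      \<open>C\<close> the difference \<open>\<gamma> - h\<close> is constant. Together
      \<open>h\<close> is constant on \<open>N\<close>.\<close>
    have K\<gamma>: "\<gamma> v = \<gamma> z" if "v \<in> K" for v
    proof -
      have "v \<notin> C \<and> \<gamma> v = \<gamma> z"
        using that unfolding K_def mem_Collect_eq
      proof induction
        case base
        then show ?case using z CL by auto
      next
        case (step u v)
        then show ?case using \<gamma>[of u v] by (simp add: c_def)
      qed
      then show ?thesis by simp
    qed
    have N\<gamma>: "\<gamma> v = \<gamma> z" if "v \<in> N" for v
    proof -
      obtain k where k: "k \<in> K" "k \<rightarrow>\<^bsub>G\<^esub> v" using \<open>v \<in> N\<close> by (auto simp: N_def)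
      then show ?thesis using \<gamma>[OF k(2)] K\<gamma>[OF k(1)] KM[OF k(1)] by (simp add: c_def)
    qed
    have C\<gamma>: "\<gamma> v - h v = \<gamma> a - h a" if "v \<in> C" for v
    proof -
      have "v \<in> C \<and> \<gamma> v - h v = \<gamma> a - h a"
        using that unfolding C_def mem_Collect_eq
      proof induction
        case (step u v)
        then have "u \<in> C" "v \<in> C" using Cstep unfolding C_def by auto
        with step \<gamma>[of u v] show ?case by (auto simp: c_def C_def)
      qed (use aC in \<open>auto simp: C_def\<close>)
      then show ?thesis by simp
    qed
    have "h m = h n" using N\<gamma>[OF mn(1)] N\<gamma>[OF mn(2)] C\<gamma>[of m] C\<gamma>[of n] mn by (simp add: N_def)
    then show False using lt by (simp add: h_def)
  qed
  have "\<exists>k. \<forall>v\<in>N. x v = k" using const by (meson order_antisym)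
  moreover have "separating_set G N"
    unfolding separating_set_def vertex_split_def
  proof (intro conjI exI ballI)
    show "N \<subseteq> ?V" using CL by (auto simp: N_def)
    show "K \<union> (?V - N - K) = ?V - N" using KM by (auto simp: N_def)
    \<comment> \<open>Both ends of the initial edge lie in \<open>C\<close> but on different levels
      of \<open>x\<close>; the one outside \<open>N\<close> makes the other side of the split
      nonempty.\<close>
    have "a \<notin> N \<or> b \<notin> N" using const ab(2) by (meson order_antisym)
    then show "?V - N - K \<noteq> {}" using abV aC bC KM by auto
    show "\<not> u \<rightarrow>\<^bsub>G\<^esub> v" if "u \<in> K" "v \<in> ?V - N - K" for u v
      using that Kstep by (auto simp: N_def)
  qed (use zK in auto)
  ultimately show ?thesis by blast
qed

context raag_over_graph begin

text \<open>After subtraction of \<open>k\<close> the function vanishes on \<open>N\<close>, so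
  edges cannot link its values on the two sides. A witness is its restriction to one side or, if it
  vanishes on a side, the indicator of that side.\<close>

lemma resonant_if_constant_on_separating_set:
  assumes sym: "symmetric G" and N: "separating_set G N" "N \<noteq> {}" and k: "\<And>v. v \<in> N \<Longrightarrow> x v = k"
  shows "resonant (bestvina_brady G) (raag_character x)"
proof -
  define x' where "x' v = x v - k" for v
  obtain P Q where PQ: "vertex_split G (verts G - N) P Q"
    using N(1) unfolding separating_set_def by blast
  obtain n where n: "n \<in> N" "n \<in> verts G" using N unfolding separating_set_def by blast
  have x'N: "x' v = 0" if "v \<in> N" for v using k[OF that] by (simp add: x'_def)
  have cut: "\<not> u \<rightarrow>\<^bsub>G\<^esub> v" "\<not> v \<rightarrow>\<^bsub>G\<^esub> u" if "u \<in> P" "v \<in> Q" for u v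
    using PQ that arcs_ends_symmetric[OF sym] unfolding vertex_split_def by blast+
  have cover: "v \<in> N \<or> v \<in> P \<or> v \<in> Q" if "v \<in> verts G" for v
    using PQ that unfolding vertex_split_def by blast
  have disj: "v \<notin> N" "v \<in> P \<Longrightarrow> v \<notin> Q" "v \<in> verts G" if "v \<in> P \<or> v \<in> Q" for v
    using PQ that unfolding vertex_split_def by blast+
  have ne: "P \<noteq> {}" "Q \<noteq> {}" using PQ unfolding vertex_split_def by auto
  have side: "resonant (bestvina_brady G) (raag_character x')"
    if S: "S = P \<or> S = Q" "\<And>v. v \<in> S \<Longrightarrow> x' v = 0" for S
  proof (rule resonant_bestvina_bradyI[where y = "\<lambda>v. if v \<in> S then 1 else 0"])
    show "x' u * (if v \<in> S then 1 else 0) = x' v * (if u \<in> S then 1 else 0)"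
      if uv: "u \<rightarrow>\<^bsub>G\<^esub> v" for u v
      using S cover[of u] cover[of v] adj_verts[OF uv] cut uv x'N by auto
    show "\<not> (\<exists>s t. \<forall>v\<in>verts G. (if v \<in> S then 1 else 0) = s * x' v + t)"
    proof
      assume "\<exists>s t. \<forall>v\<in>verts G. (if v \<in> S then 1 else 0) = s * x' v + t"
      then obtain s t where st: "\<And>v. v \<in> verts G \<Longrightarrow> (if v \<in> S then 1 else 0) = s * x' v + t" by blast
      obtain p where p: "p \<in> S" using S ne by blast
      \<comment> \<open>The affine relation would give \<open>t = 0\<close> at \<open>n\<close> and
        \<open>t = 1\<close> at \<open>p\<close>.\<close>
      have "n \<notin> S" using S disj n by blast
      then show False using st[OF n(2)] st[of p] x'N[OF n(1)] S(2)[OF p] S(1) p disj by auto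
    qed
  qed
  have "resonant (bestvina_brady G) (raag_character x')"
  proof (cases "(\<forall>v\<in>P. x' v = 0) \<or> (\<forall>v\<in>Q. x' v = 0)")
    case True
    then show ?thesis using side by blast
  next
    case False
    then obtain p q where p: "p \<in> P" "x' p \<noteq> 0" and q: "q \<in> Q" "x' q \<noteq> 0" by blast
    show ?thesis
    proof (rule resonant_bestvina_bradyI[where y = "\<lambda>v. if v \<in> P then x' v else 0"])
      show "x' u * (if v \<in> P then x' v else 0) = x' v * (if u \<in> P then x' u else 0)"
        if uv: "u \<rightarrow>\<^bsub>G\<^esub> v" for u v
        using cover[of u] cover[of v] adj_verts[OF uv] cut uv x'N by auto
      show "\<not> (\<exists>s t. \<forall>v\<in>verts G. (if v \<in> P then x' v else 0) = s * x' v + t)"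
      proof
        assume "\<exists>s t. \<forall>v\<in>verts G. (if v \<in> P then x' v else 0) = s * x' v + t"
        then obtain s t where st: "\<And>v. v \<in> verts G \<Longrightarrow> (if v \<in> P then x' v else 0) = s * x' v + t"
          by blast
        have "t = 0" using st[OF n(2)] x'N[OF n(1)] disj n by auto
        moreover have "q \<notin> P" using disj q by blast
        ultimately show False using st[of p] st[of q] p q disj by auto
      qed
    qed
  qed
  moreover have "raag_character x' g = raag_character x g" if "g \<in> carrier (bestvina_brady G)" for g
    using raag_character_affine[of x' 1 x "- k", OF _ that] by (simp add: x'_def)
  ultimately show ?thesis using resonant_cong by metis
qed

lemma resonant_bestvina_brady_iff:
  assumes G: "graph G" and b: "biconnected G"
    and sc: "simply_connected (geometric_realization (flag_complex G))"
    and ex: "separating_set G M"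
  shows "resonant (bestvina_brady G) (raag_character x) \<longleftrightarrow>
    (\<exists>N k. separating_set G N \<and> (\<forall>v\<in>N. x v = k))"
proof
  interpret graph G by (rule G)
  have conn: "Digraph_Component.connected G" using b by (simp add: biconnected_def)
  {
    assume "resonant (bestvina_brady G) (raag_character x)"
    then obtain y where y: "\<And>u v w. u \<rightarrow>\<^bsub>G\<^esub> v \<Longrightarrow> v \<rightarrow>\<^bsub>G\<^esub> w \<Longrightarrow> u \<rightarrow>\<^bsub>G\<^esub> w \<Longrightarrow>
        (x u - x v) * (y v - y w) = (x v - x w) * (y u - y v)"
      "\<not> (\<exists>s t. \<forall>v\<in>verts G. y v = s * x v + t)"
      using resonant_bestvina_bradyD[OF sym_arcs] by metis
    show "\<exists>N k. separating_set G N \<and> (\<forall>v\<in>N. x v = k)"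
    proof (cases "\<exists>k. \<forall>v\<in>verts G. x v = k")
      case True
      \<comment> \<open>A constant function induces the trivial character, for which the given
        separating set \<open>M\<close> serves.\<close>
      then show ?thesis using ex unfolding separating_set_def by blast
    next
      case False
      show ?thesis by (rule level_set_separates[OF G conn sc y False])
    qed
  }
  {
    assume "\<exists>N k. separating_set G N \<and> (\<forall>v\<in>N. x v = k)"
    then show "resonant (bestvina_brady G) (raag_character x)"
      using resonant_if_constant_on_separating_set[OF sym_arcs] biconnected_separating_set[OF G b]
      by (metis empty_iff)
  }
qed

end

section \<open>Coordinate subspaces\<close>

text \<open>A nonempty set of this kind is a linear subspace: \<open>y = x\<close> and
  \<open>t = -1\<close> give zero, and the rest follows.\<close>

definition line_closed :: "('a \<Rightarrow> real) set \<Rightarrow> bool" where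
  "line_closed E \<longleftrightarrow> (\<forall>x\<in>E. \<forall>y\<in>E. \<forall>t. (\<lambda>v. x v + t * y v) \<in> E)"

lemma line_closedD: "line_closed E \<Longrightarrow> x \<in> E \<Longrightarrow> y \<in> E \<Longrightarrow> (\<lambda>v. x v + t * y v) \<in> E"
  by (simp add: line_closed_def)

lemma line_closed_cover:
  assumes "finite I" and E: "line_closed E" "E \<noteq> {}"
    and S: "\<And>i. i \<in> I \<Longrightarrow> line_closed (S i)" and cover: "E \<subseteq> (\<Union>i\<in>I. S i)"
  shows "\<exists>i\<in>I. E \<subseteq> S i"
  using assms(1) S cover
proof (induction I rule: finite_induct)
  case empty
  then show ?case using E by auto
next
  case (insert j I)
  show ?case
  proof (rule ccontr)
    assume c: "\<not> ?case"
    then obtain x where x: "x \<in> E" "x \<notin> S j" by blast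
    have "\<not> E \<subseteq> (\<Union>i\<in>I. S i)" using insert.IH insert.prems c by auto
    then obtain y where y: "y \<in> E" "\<And>i. i \<in> I \<Longrightarrow> y \<notin> S i" by blast
    \<comment> \<open>Two of the infinitely many points of this line share some \<open>S i\<close>,
      which then contains \<open>x\<close> and \<open>y\<close>. But \<open>x\<close> excludes
      \<open>i = j\<close>, and \<open>y\<close> excludes \<open>i \<in> I\<close>.\<close>
    define p where "p t = (\<lambda>v. y v + t * x v)" for t
    have "p t \<in> E" for t using line_closedD[OF E(1) y(1) x(1)] by (simp add: p_def)
    then have "\<exists>i\<in>insert j I. p t \<in> S i" for t using insert.prems(2) by blast
    then obtain f where f: "\<And>t. f t \<in> insert j I" "\<And>t. p t \<in> S (f t)" by metis
    have "infinite (UNIV :: real set)" by (rule infinite_UNIV_char_0)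
    moreover have "finite (range f)"
      by (rule finite_subset[of _ "insert j I"]) (use f(1) insert.hyps(1) in auto)
    ultimately have "\<not> inj f" using finite_imageD by blast
    then obtain s t where st: "f s = f t" "s \<noteq> t" by (auto simp: inj_def)
    define i where "i = f t"
    have i: "i \<in> insert j I" "p s \<in> S i" "p t \<in> S i" using f st by (auto simp: i_def) metis
    have lc: "line_closed (S i)" using insert.prems(1) i(1) .
    define q where "q = (\<lambda>v. p s v + (-1) * p t v)"
    have "q \<in> S i" unfolding q_def by (rule line_closedD[OF lc i(2,3)])
    have q: "q = (\<lambda>v. (s - t) * x v)" by (auto simp: q_def p_def algebra_simps)
    \<comment> \<open>Scaling \<open>q\<close> to \<open>x\<close> is done by adding a multiple of
      \<open>q\<close> to itself.\<close>
    have "(\<lambda>v. q v + (1 / (s - t) - 1) * q v) \<in> S i"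
      by (rule line_closedD[OF lc \<open>q \<in> S i\<close> \<open>q \<in> S i\<close>])
    also have "(\<lambda>v. q v + (1 / (s - t) - 1) * q v) = x"
      using st(2) by (auto simp: q field_simps)
    finally have xi: "x \<in> S i" .
    have "(\<lambda>v. p t v + (- t) * x v) \<in> S i" by (rule line_closedD[OF lc i(3) xi])
    then have "y \<in> S i" by (simp add: p_def)
    then show False using i(1) xi x y by blast
  qed
qed

lemma line_closed_constant_on: "line_closed {a. \<exists>k. \<forall>v\<in>N. a v = k}"
  unfolding line_closed_def
proof (intro ballI allI)
  fix x y :: "'a \<Rightarrow> real" and t
  assume "x \<in> {a. \<exists>k. \<forall>v\<in>N. a v = k}" "y \<in> {a. \<exists>k. \<forall>v\<in>N. a v = k}"
  then obtain k l where "\<forall>v\<in>N. x v = k" "\<forall>v\<in>N. y v = l" by blast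
  then have "\<forall>v\<in>N. x v + t * y v = k + t * l" by simp
  then show "(\<lambda>v. x v + t * y v) \<in> {a. \<exists>k. \<forall>v\<in>N. a v = k}" by blast
qed

definition minimal_separating_set :: "('a,'b) pre_digraph \<Rightarrow> 'a set \<Rightarrow> bool" where
  "minimal_separating_set G N \<longleftrightarrow> separating_set G N \<and> (\<forall>M\<subset>N. \<not> separating_set G M)"

text \<open>
  \<open>U\<close> gives coordinates, indexed by \<open>L\<close>, on the space of functions on the vertices modulo constants,
  in which the resonant functions are described by their supports.
\<close>

locale resonance_coordinates =
  fixes G :: "('a,'b) pre_digraph" and L :: "'c set" and U :: "('a \<Rightarrow> real) \<Rightarrow> 'c \<Rightarrow> real"
    and R :: "('c \<Rightarrow> real) \<Rightarrow> bool"
  assumes finite_verts: "finite (verts G)" and finite_L: "finite L"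
    and linear: "l \<in> L \<Longrightarrow> U (\<lambda>v. a v + t * b v) l = U a l + t * U b l"
    and inj: "(\<And>l. l \<in> L \<Longrightarrow> U a l = U b l) \<Longrightarrow> \<exists>k. \<forall>v\<in>verts G. a v = b v + k"
    and surj: "\<exists>a. \<forall>l\<in>L. U a l = x l"
    and shrink: "R x \<Longrightarrow> (\<And>l. l \<in> L \<Longrightarrow> x l = 0 \<Longrightarrow> x' l = 0) \<Longrightarrow> R x'"
    and R_iff: "R (U a) \<longleftrightarrow> (\<exists>N k. separating_set G N \<and> (\<forall>v\<in>N. a v = k))"
    and two_elements: "separating_set G N \<Longrightarrow> \<exists>u\<in>N. \<exists>v\<in>N. u \<noteq> v"
begin

definition constants :: "'a set \<Rightarrow> ('a \<Rightarrow> real) set" where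
  "constants N = {a. \<exists>k. \<forall>v\<in>N. a v = k}"

definition coords :: "'a set \<Rightarrow> 'c set" where
  "coords N = {l \<in> L. \<exists>a\<in>constants N. U a l \<noteq> 0}"

lemma zero_constants: "(\<lambda>_. 0) \<in> constants N"
  by (auto simp: constants_def)

text \<open>
  Being resonant depends only on the support, so the coordinate subspace spanned by \<open>constants N\<close>
  consists of resonant elements and is therefore contained in some \<open>constants M\<close>.
\<close>

lemma constants_eq_coordinate_subspace:
  assumes N: "minimal_separating_set G N"
  shows "a \<in> constants N \<longleftrightarrow> (\<forall>l\<in>L. l \<notin> coords N \<longrightarrow> U a l = 0)"
proof -
  define F where "F = {a. \<forall>l\<in>L. l \<notin> coords N \<longrightarrow> U a l = 0}"
  have EF: "constants N \<subseteq> F" by (auto simp: F_def coords_def)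
  have lcE: "line_closed (constants M)" for M
    unfolding constants_def by (rule line_closed_constant_on)
  \<comment> \<open>General position: no coordinate in \<open>coords N\<close> vanishes identically
    on \<open>constants N\<close>, so some element has all of them nonzero.\<close>
  have "\<not> constants N \<subseteq> (\<Union>l\<in>coords N. {a. U a l = 0})"
  proof
    assume "constants N \<subseteq> (\<Union>l\<in>coords N. {a. U a l = 0})"
    then have "\<exists>l\<in>coords N. constants N \<subseteq> {a. U a l = 0}"
    proof (intro line_closed_cover lcE)
      show "finite (coords N)" using finite_L by (simp add: coords_def)
      show "line_closed {a. U a l = 0}" if "l \<in> coords N" for l
        using that linear by (auto simp: line_closed_def coords_def)
    qed (use zero_constants in auto)
    then show False by (auto simp: coords_def)
  qed
  then obtain e where e: "e \<in> constants N" "\<And>l. l \<in> coords N \<Longrightarrow> U e l \<noteq> 0" by blast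
  have "R (U e)"
    using e(1) N unfolding R_iff minimal_separating_set_def constants_def by blast
  have "F \<subseteq> (\<Union>M\<in>{M. separating_set G M}. constants M)"
  proof
    fix a assume a: "a \<in> F"
    have "R (U a)"
      by (rule shrink[OF \<open>R (U e)\<close>]) (use a e(2) in \<open>auto simp: F_def\<close>)
    then show "a \<in> (\<Union>M\<in>{M. separating_set G M}. constants M)"
      unfolding R_iff constants_def by auto
  qed
  moreover have "line_closed F"
    using linear by (auto simp: line_closed_def F_def)
  moreover have "finite {M. separating_set G M}"
    by (rule finite_subset[of _ "Pow (verts G)"]) (use finite_verts in \<open>auto simp: separating_set_def\<close>)
  ultimately obtain M where M: "separating_set G M" "F \<subseteq> constants M"
    using line_closed_cover[of "{M. separating_set G M}" F constants] lcE EF zero_constants by blast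
  have "M \<subseteq> N"
  proof
    fix u assume u: "u \<in> M"
    show "u \<in> N"
    proof (rule ccontr)
      assume "u \<notin> N"
      \<comment> \<open>The indicator of \<open>u\<close> is constant on \<open>N\<close> but not on
        \<open>M\<close>, which has a second element.\<close>
      then have "(\<lambda>v. if v = u then 1 else 0) \<in> constants N" by (auto simp: constants_def)
      then have "(\<lambda>v. if v = u then 1 else 0 :: real) \<in> constants M" using EF M by blast
      then obtain k :: real where "\<And>v. v \<in> M \<Longrightarrow> (if v = u then 1 else 0) = k"
        unfolding constants_def by blast
      then have "v = u" if "v \<in> M" for v using that u by (metis zero_neq_one)
      then show False using two_elements[OF M(1)] by blast
    qed
  qed
  then have "M = N" using N M(1) unfolding minimal_separating_set_def by blast
  then have "F = constants N" using EF M by blast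
  then show ?thesis by (auto simp: F_def)
qed

text \<open>
  Coordinate subspaces form a distributive lattice. The indicator function of \<open>N1 \<inter> N3\<close> lies in
  \<open>E2 \<inter> (E1 + E3)\<close> but not in \<open>(E2 \<inter> E1) + (E2 \<inter> E3)\<close>, where \<open>Ei = constants Ni\<close>.
\<close>

lemma no_redundant_triangle:
  assumes N: "minimal_separating_set G N1" "minimal_separating_set G N2" "minimal_separating_set G N3"
    and v: "v1 \<in> N2" "v1 \<in> N3" "v2 \<in> N1" "v2 \<in> N3" "v3 \<in> N1" "v3 \<in> N2"
    and disj: "N1 \<inter> N2 \<inter> N3 = {}"
  shows False
proof -
  note coord = constants_eq_coordinate_subspace
  define ind :: "'a set \<Rightarrow> 'a \<Rightarrow> real" where "ind S = (\<lambda>v. if v \<in> S then 1 else 0)" for S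
  let ?a = "ind (N1 \<inter> N3)"
  have a2: "?a \<in> constants N2"
    unfolding constants_def using disj by (auto simp: ind_def intro!: exI[of _ 0])
  have a1: "ind (N3 - N1) \<in> constants N1" and a3: "ind N3 \<in> constants N3"
    by (auto simp: constants_def ind_def)
  have "?a = (\<lambda>v. ind N3 v + (-1) * ind (N3 - N1) v)" by (auto simp: ind_def)
  then have sum: "U ?a l = U (ind N3) l - U (ind (N3 - N1)) l" if "l \<in> L" for l
    using linear[OF that, of "ind N3" "-1" "ind (N3 - N1)"] by simp
  \<comment> \<open>\<open>b\<close> and \<open>c\<close> split \<open>?a\<close> into its
    coordinates inside and outside \<open>coords N1\<close>. Outside, the coordinates of
    \<open>ind (N3 - N1)\<close> vanish, so those of \<open>?a\<close> agree with those of
    \<open>ind N3\<close>; this puts \<open>c\<close> into \<open>constants N3\<close>.\<close>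
  obtain b where b: "\<And>l. l \<in> L \<Longrightarrow> U b l = (if l \<in> coords N1 then U ?a l else 0)"
    using surj[of "\<lambda>l. if l \<in> coords N1 then U ?a l else 0"] by blast
  obtain c where c: "\<And>l. l \<in> L \<Longrightarrow> U c l = (if l \<in> coords N1 then 0 else U ?a l)"
    using surj[of "\<lambda>l. if l \<in> coords N1 then 0 else U ?a l"] by blast
  have z2: "U ?a l = 0" if "l \<in> L" "l \<notin> coords N2" for l
    using a2 that unfolding coord[OF N(2)] by blast
  have z1: "U (ind (N3 - N1)) l = 0" if "l \<in> L" "l \<notin> coords N1" for l
    using a1 that unfolding coord[OF N(1)] by blast
  have z3: "U (ind N3) l = 0" if "l \<in> L" "l \<notin> coords N3" for l
    using a3 that unfolding coord[OF N(3)] by blast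
  have "b \<in> constants N1"
    unfolding coord[OF N(1)] using b by simp
  then have b23: "b v2 = b v3" using v unfolding constants_def by auto
  have "c \<in> constants N2" "c \<in> constants N3"
    unfolding coord[OF N(2)] coord[OF N(3)] using c z2 z1 z3 sum by auto
  \<comment> \<open>The vertex \<open>v1\<close> lies in both \<open>N2\<close> and
    \<open>N3\<close>; it links \<open>v3\<close> in \<open>N2\<close> with \<open>v2\<close> in
    \<open>N3\<close>.\<close>
  then have c23: "c v2 = c v3" using v unfolding constants_def by fastforce
  have "U ?a l = U (\<lambda>v. b v + 1 * c v) l" if "l \<in> L" for l
    using linear[OF that, of b 1 c] b[OF that] c[OF that] by simp
  then obtain k where k: "\<forall>v\<in>verts G. ?a v = b v + 1 * c v + k" using inj by blast
  have "v2 \<in> verts G" "v3 \<in> verts G"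
    using N v unfolding minimal_separating_set_def separating_set_def by blast+
  then have "?a v2 = ?a v3" using k b23 c23 by simp
  moreover have "v3 \<notin> N3" using v disj by blast
  ultimately show False using v by (simp add: ind_def)
qed

end

theorem theoremE:
  fixes \<Gamma> :: "('a,'b) pre_digraph"
  assumes "graph \<Gamma>"
    and "biconnected \<Gamma>"
    and "simply_connected (geometric_realization (flag_complex \<Gamma>))"
    and "\<exists>v1 v2 v3. redundant_triangle \<Gamma> v1 v2 v3"
  shows "\<not> (\<exists>\<Lambda> :: ('c,'d) pre_digraph. graph \<Lambda> \<and> bestvina_brady \<Gamma> \<cong> raag \<Lambda>)"
proof
  assume "\<exists>\<Lambda> :: ('c,'d) pre_digraph. graph \<Lambda> \<and> bestvina_brady \<Gamma> \<cong> raag \<Lambda>"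
  then obtain \<Lambda> :: "('c,'d) pre_digraph" and \<phi> where \<Lambda>: "graph \<Lambda>"
    and \<phi>: "\<phi> \<in> iso (bestvina_brady \<Gamma>) (raag \<Lambda>)"
    unfolding is_iso_def by blast
  interpret \<Lambda>: graph \<Lambda> by (rule \<Lambda>)
  interpret \<Gamma>: graph \<Gamma> by (rule assms(1))
  obtain v1 v2 v3 L1 L2 L3 where v: "v2 \<rightarrow>\<^bsub>L1\<^esub> v3" "v1 \<rightarrow>\<^bsub>L2\<^esub> v3" "v1 \<rightarrow>\<^bsub>L3\<^esub> v2"
    and L: "minimal_full_separating_subgraph L1 \<Gamma>" "minimal_full_separating_subgraph L2 \<Gamma>"
      "minimal_full_separating_subgraph L3 \<Gamma>"
    and disj: "verts L1 \<inter> verts L2 \<inter> verts L3 = {}"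
    using assms(4) unfolding redundant_triangle_def by blast
  have min: "minimal_separating_set \<Gamma> (verts M)" if "minimal_full_separating_subgraph M \<Gamma>" for M
    using minimal_full_separating_subgraphD[OF assms(1) that]
      unfolding minimal_separating_set_def by blast
  have ends: "u \<in> verts M \<and> w \<in> verts M"
    if "minimal_full_separating_subgraph M \<Gamma>" "u \<rightarrow>\<^bsub>M\<^esub> w" for M u w
    using that wf_digraph.adj_in_verts[of M u w]
    unfolding minimal_full_separating_subgraph_def separating_subgraph_def subgraph_def by blast
  have conn: "Digraph_Component.connected \<Gamma>" using assms(2) by (simp add: biconnected_def)
  then obtain r where r: "r \<in> verts \<Gamma>" by (auto simp: connected_conv)
  interpret raag_over_graph \<Gamma> r
    by unfold_locales (use r connected_rtrancl[OF \<Gamma>.sym_arcs conn r] in auto)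
  define \<psi> where "\<psi> = inv_into (carrier (bestvina_brady \<Gamma>)) \<phi>"
  have \<psi>: "\<psi> \<in> iso (raag \<Lambda>) (bestvina_brady \<Gamma>)"
    unfolding \<psi>_def by (rule BB.iso_set_sym[OF \<phi>])
  have bij: "bij_betw \<phi> (carrier (bestvina_brady \<Gamma>)) (carrier (raag \<Lambda>))"
    using \<phi> by (simp add: iso_def)
  have \<psi>\<phi>: "\<psi> (\<phi> g) = g" and \<phi>B: "\<phi> g \<in> carrier (raag \<Lambda>)" if "g \<in> carrier (bestvina_brady \<Gamma>)" for g
    using bij that unfolding \<psi>_def by (auto simp: bij_betw_def)
  have \<phi>\<psi>: "\<phi> (\<psi> h) = h" and \<psi>B: "\<psi> h \<in> carrier (bestvina_brady \<Gamma>)" if "h \<in> carrier (raag \<Lambda>)" for h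
    using bij that unfolding \<psi>_def by (auto simp: bij_betw_def f_inv_into_f inv_into_into)
  \<comment> \<open>The character given by \<open>a\<close> is transported to
    \<open>raag \<Lambda>\<close> and recorded by its values on the standard generators.\<close>
  define U where "U a l = raag_character a (\<psi> (raag_generator \<Lambda> l))" for a :: "'a \<Rightarrow> real" and l
  have U: "raag_character a (\<psi> h) = raag_character (U a) h" if "h \<in> carrier (raag \<Lambda>)" for a h
    using raag_character_unique[OF additive_character_comp_iso[OF \<psi> additive_bestvina_brady_character] that, of a]
    by (simp add: U_def[abs_def])
  have U_eq: "raag_character (U a) (\<phi> g) = raag_character a g"
    if "g \<in> carrier (bestvina_brady \<Gamma>)" for a g
    using U[OF \<phi>B[OF that]] \<psi>\<phi>[OF that] by simp
  interpret resonance_coordinates \<Gamma> "verts \<Lambda>" U "\<lambda>x. resonant (raag \<Lambda>) (raag_character x)"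
  proof
    show "U (\<lambda>v. a v + t * b v) l = U a l + t * U b l" if "l \<in> verts \<Lambda>" for l a t b
      unfolding U_def
      by (rule raag_character_linear[of _ \<Gamma>]) (use \<psi>B raag_generator_closed[OF that] in \<open>auto simp: BB_carrier_iff\<close>)
    show "\<exists>k. \<forall>v\<in>verts \<Gamma>. a v = b v + k" if eq: "\<And>l. l \<in> verts \<Lambda> \<Longrightarrow> U a l = U b l" for a b
    proof -
      have "word_sum (U a) w = word_sum (U b) w" if "w \<in> gwords (verts \<Lambda>)" for w
        using that by (induction w) (auto simp: eq)
      then have "raag_character (U a) h = raag_character (U b) h" if "h \<in> carrier (raag \<Lambda>)" for h
        using that by (auto elim!: raag_carrierE simp: raag_character_class)
      then have "\<forall>g\<in>carrier (bestvina_brady \<Gamma>). raag_character a g = 1 * raag_character b g"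
        using U_eq \<phi>B by (metis mult_1)
      then show ?thesis unfolding raag_character_eq_iff by simp
    qed
    show "\<exists>a. \<forall>l\<in>verts \<Lambda>. U a l = x l" for x
    proof -
      \<comment> \<open>Every character pulled back along \<open>\<phi>\<close> comes from a
        function on the vertices of \<open>\<Gamma>\<close>, because characters of the kernel
        extend.\<close>
      have "\<exists>a. \<forall>g\<in>carrier (bestvina_brady \<Gamma>). (raag_character x \<circ> \<phi>) g = raag_character a g"
        using char_extends[OF additive_character_comp_iso[OF \<phi> additive_raag_character]] by blast
      then obtain a where "\<And>g. g \<in> carrier (bestvina_brady \<Gamma>) \<Longrightarrow>
        raag_character x (\<phi> g) = raag_character a g"
        by auto
      then have "U a l = x l" if "l \<in> verts \<Lambda>" for l
        unfolding U_def using \<psi>B \<phi>\<psi> raag_generator_closed[OF that] raag_character_generator[OF that]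
        by metis
      then show ?thesis by blast
    qed
    show "resonant (raag \<Lambda>) (raag_character x')"
      if "resonant (raag \<Lambda>) (raag_character x)" "\<And>l. l \<in> verts \<Lambda> \<Longrightarrow> x l = 0 \<Longrightarrow> x' l = 0" for x x'
      using resonant_raag_shrink_support[OF \<Lambda>.wf_digraph \<Lambda>.sym_arcs that] .
    show "resonant (raag \<Lambda>) (raag_character (U a)) \<longleftrightarrow>
        (\<exists>N k. separating_set \<Gamma> N \<and> (\<forall>v\<in>N. a v = k))" for a
    proof -
      have "resonant (raag \<Lambda>) (raag_character (U a)) \<longleftrightarrow> resonant (raag \<Lambda>) (raag_character a \<circ> \<psi>)"
        by (rule resonant_cong) (simp add: U)
      moreover have "resonant (bestvina_brady \<Gamma>) (raag_character a) \<longleftrightarrow>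
          resonant (bestvina_brady \<Gamma>) (raag_character (U a) \<circ> \<phi>)"
        by (rule resonant_cong) (simp add: U_eq)
      ultimately have "resonant (raag \<Lambda>) (raag_character (U a)) \<longleftrightarrow>
        resonant (bestvina_brady \<Gamma>) (raag_character a)"
        using resonant_comp_iso[OF \<phi>] resonant_comp_iso[OF \<psi>] by blast
      also have "separating_set \<Gamma> (verts L1)"
        using min[OF L(1)] by (simp add: minimal_separating_set_def)
      note resonant_bestvina_brady_iff[OF assms(1-3) this]
      finally show ?thesis .
    qed
    show "\<exists>u\<in>N. \<exists>v\<in>N. u \<noteq> v" if "separating_set \<Gamma> N" for N
      using biconnected_separating_set[OF assms(1,2) that] .
  qed simp_all
  show False
    using no_redundant_triangle[OF min[OF L(1)] min[OF L(2)] min[OF L(3)], of v1 v2 v3]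
      ends[OF L(1) v(1)] ends[OF L(2) v(2)] ends[OF L(3) v(3)] disj by blast
qed

end
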